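(* There exists an absolute constant $C$ such that the following holds for all positive integers $d_1,d_2,n,r$ and all $0<\zeta<1$. Let $(i_k,j_k)$, $k=1,\dots,n$, be independent copies of a uniform random variable on $\{1,\dots,d_1\}\times\{1,\dots,d_2\}$. Then $$\sup_{|||M|||\le1}\left|\frac{d_1d_2}{n}\sum_{k=1}^n|\langle e_{i_k}\otimes e_{j_k},M\rangle|^2-\|M\|_{\mathrm F}^2\right|\le C\,d_1d_2\left(\rho\vee\sqrt\rho\right),\qquad\rho:=\frac{r(d_1+d_2)\ln^3(d_1+d_2)\vee\ln^2(\zeta^{-1})}{n},$$ holds with probability at least $1-\zeta$.
   Context: $a\vee b=\max(a,b)$. For $M\in\mathbb{R}^{d_1\times d_2}$, $\langle e_i\otimes e_j,M\rangle$ is the $(i,j)$ entry of $M$; $\|\cdot\|_{\mathrm F}$ is the Frobenius norm. The supremum is over $M\in\mathbb{R}^{d_1\times d_2}$ with $|||M|||=\max(\|M\|_\infty,\ \|M\|_{\max}/\sqrt r)\le1$, where $\|M\|_\infty=\max_{i,j}|M_{ij}|$ and the max norm is $\|M\|_{\max}=\inf\{\|U^\top\|_{1\to2}\|V^\top\|_{1\to2}:UV^\top=M\}$, the infimum over $U\in\mathbb{R}^{d_1\times d}$, $V\in\mathbb{R}^{d_2\times d}$, $d\in\mathbb{N}$, with $\|A\|_{1\to2}$ denoting the maximum Euclidean norm of the columns of $A$. *)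

theory Defs
  imports "HOL-Probability.Probability" "Jordan_Normal_Form.Matrix"
begin

(* Matrices of varying size are real matrices A with A : carrier_mat d1 d2; row and column
   indices therefore start at 0. The Max operators below are only meaningful for d1, d2 > 0. *)

definition entry_sup_norm :: "real mat \<Rightarrow> real" where
  "entry_sup_norm M = Max {\<bar>M $$ (i, j)\<bar> |i j. i < dim_row M \<and> j < dim_col M}"

definition frobenius_norm :: "real mat \<Rightarrow> real" where
  "frobenius_norm M = L2_set (\<lambda>p. M $$ p) ({..<dim_row M} \<times> {..<dim_col M})"

definition norm_1_to_2 :: "real mat \<Rightarrow> real" where
  "norm_1_to_2 A = Max {L2_set (\<lambda>i. A $$ (i, j)) {..<dim_row A} |j. j < dim_col A}"

definition max_norm :: "real mat \<Rightarrow> real" where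
  "max_norm M = Inf {norm_1_to_2 (transpose_mat U) * norm_1_to_2 (transpose_mat V) |U V d.
      U \<in> carrier_mat (dim_row M) d \<and> V \<in> carrier_mat (dim_col M) d \<and> U * transpose_mat V = M}"

definition triple_norm :: "nat \<Rightarrow> real mat \<Rightarrow> real" where
  "triple_norm r M = max (entry_sup_norm M) (max_norm M / sqrt (real r))"

definition sampling_deviation :: "nat \<Rightarrow> nat \<Rightarrow> nat \<Rightarrow> nat \<Rightarrow> (nat \<Rightarrow> nat \<times> nat) \<Rightarrow> real" where
  "sampling_deviation d1 d2 n r x =
    (SUP M \<in> {M \<in> carrier_mat d1 d2. triple_norm r M \<le> 1}.
      \<bar>real d1 * real d2 / real n * (\<Sum>k=1..n. \<bar>M $$ x k\<bar>\<^sup>2) - (frobenius_norm M)\<^sup>2\<bar>)"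

definition uniform_index :: "nat \<Rightarrow> nat \<Rightarrow> (nat \<times> nat) pmf" where
  "uniform_index d1 d2 = pmf_of_set ({..<d1} \<times> {..<d2})"

definition independent_uniform_indices ::
    "'a measure \<Rightarrow> nat \<Rightarrow> nat \<Rightarrow> nat \<Rightarrow> (nat \<Rightarrow> 'a \<Rightarrow> nat \<times> nat) \<Rightarrow> bool" where
  "independent_uniform_indices \<Omega> d1 d2 n X \<longleftrightarrow>
    prob_space \<Omega> \<and>
    prob_space.indep_vars \<Omega> (\<lambda>_. count_space UNIV) X {1..n} \<and>
    (\<forall>k\<in>{1..n}. distr \<Omega> (count_space UNIV) (X k) = measure_pmf (uniform_index d1 d2))"

(* The canonical model of n independent uniform indices. A theorem of the form "there is C such
   that for all \<Omega> :: 'a measure ..." formally lets C depend on the type 'a; requiring the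
   same C to work for this monomorphic law as well rules that out, because the probability in
   question depends only on the joint law of the indices. The value (0, 0) is the irrelevant
   default outside {1..n}. *)
definition index_sample_pmf :: "nat \<Rightarrow> nat \<Rightarrow> nat \<Rightarrow> (nat \<Rightarrow> nat \<times> nat) pmf" where
  "index_sample_pmf d1 d2 n = Pi_pmf {1..n} (0, 0) (\<lambda>_. uniform_index d1 d2)"

definition sampling_rate :: "nat \<Rightarrow> nat \<Rightarrow> nat \<Rightarrow> nat \<Rightarrow> real \<Rightarrow> real" where
  "sampling_rate d1 d2 n r \<zeta> =
    max (real r * real (d1 + d2) * ln (real (d1 + d2)) ^ 3) ((ln (inverse \<zeta>))\<^sup>2) / real n"

end

theory Submission
  imports Defs
begin

text \<open>
  Write \<open>p\<^sub>k\<close> for the sampled positions. Divided by \<open>d1 d2\<close>, the deviation compares, uniformly over the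
  ball, the empirical mean of \<open>M(p\<^sub>k)\<^sup>2\<close> with the mean of \<open>M\<^sup>2\<close> over all entries. It is controlled by its
  exponential moment.

  Introducing an independent copy of the sample and random signs bounds that moment by the moment of
  a Rademacher process indexed by the squares \<open>M\<^sup>2\<close> (\<open>symmetrization\<close>). Since the entries lie in
  \<open>[-1, 1]\<close>, squaring is \<open>2\<close>-Lipschitz there, and the contraction principle, valid for exponential
  moments, replaces \<open>M\<^sup>2\<close> by a multiple of \<open>M\<close> (\<open>Rademacher_contraction\<close>). The signed sum of the
  entries of \<open>M\<close> at the sampled positions is linear in \<open>M\<close>. If \<open>M = U V\<^sup>T\<close> with products of row norms at
  most \<open>R\<close>, Grothendieck's inequality bounds it by \<open>8 R\<close> times its largest value over the rank-one
  sign matrices (\<open>Grothendieck_inequality\<close>). There are only \<open>2^(d1 + d2)\<close> pairs of sign vectors, so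
  the exponential moment of that maximum is at most the sum of \<open>2^(d1 + d2)\<close> moments of plain
  Rademacher sums, and Markov's inequality gives, with probability at least \<open>1 - \<zeta>\<close>, a deviation of
  order \<open>R sqrt ((d1 + d2 + ln (1/\<zeta>)) / n)\<close>.

  The radius \<open>R\<close> can be taken as \<open>2 sqrt (min r d1)\<close>: the max norm gives \<open>2 sqrt r\<close>, and the
  factorization of \<open>M\<close> through the identity gives \<open>sqrt d1\<close>. The minimum is what makes the mixed term
  \<open>R\<^sup>2 ln (1/\<zeta>)\<close> harmless: when \<open>ln (1/\<zeta>)\<close> exceeds \<open>d1 + d2\<close> it is at most a multiple of
  \<open>ln\<^sup>2 (1/\<zeta>)\<close>, and otherwise it is dominated by \<open>r (d1 + d2)\<close>. The resulting bound is a constant times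
  \<open>sqrt \<rho>\<close>.

  All expectations are finite sums: random signs range over the subsets of an index set, samples over
  a finite function space, and only the last step transfers the count of bad samples to an arbitrary
  probability space.
\<close>

section \<open>Rademacher sums\<close>

text \<open>A vector of signs is encoded by the set of indices with sign \<open>+1\<close>, so that a uniform average over signs
  is a sum over a power set.\<close>
definition sgn_of :: "'a set \<Rightarrow> 'a \<Rightarrow> real" where
  "sgn_of A k = (if k \<in> A then 1 else -1)"

lemma abs_sgn_of [simp]: "\<bar>sgn_of A k\<bar> = 1"
  by (simp add: sgn_of_def)

lemma sgn_of_insert:
  assumes "k \<notin> K" "A \<subseteq> K"
  shows "sgn_of (insert k A) k = 1" "sgn_of A k = -1"
    and "i \<in> K \<Longrightarrow> sgn_of (insert k A) i = sgn_of A i"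
  using assms by (auto simp: sgn_of_def)

text \<open>Every average over signs is computed by splitting off one index at a time with this rule.\<close>
lemma sum_Pow_insert:
  fixes f :: "'a set \<Rightarrow> 'b :: comm_monoid_add"
  assumes "finite K" "k \<notin> K"
  shows "(\<Sum>A\<in>Pow (insert k K). f A) = (\<Sum>A\<in>Pow K. f (insert k A) + f A)"
proof -
  have inj: "inj_on (insert k) (Pow K)"
    using assms by (intro inj_onI) (metis PowD insert_ident subsetD)
  have "(\<Sum>A\<in>Pow (insert k K). f A) = sum f (Pow K) + sum f (insert k ` Pow K)"
    unfolding Pow_insert using assms by (intro sum.union_disjoint) auto
  also have "sum f (insert k ` Pow K) = (\<Sum>A\<in>Pow K. f (insert k A))"
    by (simp add: sum.reindex[OF inj])
  finally show ?thesis by (simp add: sum.distrib add.commute)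
qed

lemma sgn_of_sum_insert:
  assumes "finite K" "k \<notin> K" "A \<subseteq> K"
  shows "(\<Sum>i\<in>insert k K. sgn_of (insert k A) i * x i) = (\<Sum>i\<in>K. sgn_of A i * x i) + x k"
    and "(\<Sum>i\<in>insert k K. sgn_of A i * x i) = (\<Sum>i\<in>K. sgn_of A i * x i) - x k"
proof -
  have "(\<Sum>i\<in>K. sgn_of (insert k A) i * x i) = (\<Sum>i\<in>K. sgn_of A i * x i)"
    by (intro sum.cong refl) (use assms in \<open>simp add: sgn_of_insert\<close>)
  then show "(\<Sum>i\<in>insert k K. sgn_of (insert k A) i * x i) = (\<Sum>i\<in>K. sgn_of A i * x i) + x k"
    using assms by (simp add: sgn_of_insert)
  show "(\<Sum>i\<in>insert k K. sgn_of A i * x i) = (\<Sum>i\<in>K. sgn_of A i * x i) - x k"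
    using assms by (simp add: sgn_of_insert)
qed

lemma sgn_sum_uminus:
  assumes "A \<subseteq> K"
  shows "(\<Sum>k\<in>K. sgn_of (K - A) k * x k) = - (\<Sum>k\<in>K. sgn_of A k * x k)"
  unfolding sum_negf[symmetric] by (intro sum.cong) (auto simp: sgn_of_def)

lemma sum_Pow_complement: "(\<Sum>A\<in>Pow K. f (K - A)) = (\<Sum>A\<in>Pow K. f A)"
  by (rule sum.reindex_bij_witness[where i="\<lambda>A. K - A" and j="\<lambda>A. K - A"]) auto

text \<open>Distinct signs are uncorrelated, so \<open>x \<mapsto> (\<Sum>l. \<epsilon>\<^sub>l x\<^sub>l)\<close> is up to scaling an isometric embedding into
  functions on the cube. This takes the place of the Gaussian functionals in the proof of
  Grothendieck's inequality.\<close>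
lemma Rademacher_product:
  assumes "finite L"
  shows "(\<Sum>A\<in>Pow L. (\<Sum>l\<in>L. sgn_of A l * x l) * (\<Sum>l\<in>L. sgn_of A l * y l))
    = 2 ^ card L * (\<Sum>l\<in>L. x l * y l)"
  using assms
proof (induction L rule: finite_induct)
  case (insert k L)
  define X where "X A = (\<Sum>l\<in>L. sgn_of A l * x l)" for A
  define Y where "Y A = (\<Sum>l\<in>L. sgn_of A l * y l)" for A
  have "(\<Sum>A\<in>Pow (insert k L). (\<Sum>l\<in>insert k L. sgn_of A l * x l) * (\<Sum>l\<in>insert k L. sgn_of A l * y l))
    = (\<Sum>A\<in>Pow L. (X A + x k) * (Y A + y k) + (X A - x k) * (Y A - y k))"
    unfolding sum_Pow_insert[OF insert.hyps] X_def Y_def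
    by (intro sum.cong refl) (simp add: sgn_of_sum_insert[OF insert.hyps] del: sum.insert)
  also have "\<dots> = (\<Sum>A\<in>Pow L. 2 * (X A * Y A) + 2 * (x k * y k))"
    by (intro sum.cong refl) (simp add: algebra_simps)
  also have "\<dots> = 2 * (\<Sum>A\<in>Pow L. X A * Y A) + 2 ^ card L * (2 * (x k * y k))"
    by (simp add: sum.distrib sum_distrib_left insert.hyps card_Pow)
  also have "\<dots> = 2 ^ card (insert k L) * (\<Sum>l\<in>insert k L. x l * y l)"
    using insert.IH insert.hyps by (simp add: X_def Y_def algebra_simps)
  finally show ?case .
qed simp

text \<open>Khintchine's inequality for the fourth moment. Splitting off one sign turns \<open>X\<^sup>4\<close> into
  \<open>X\<^sup>4 + 6 x\<^sup>2 X\<^sup>2 + x\<^sup>4\<close> on average, and with the second moment this stays below \<open>3 (\<sigma>\<^sup>2 + x\<^sup>2)\<^sup>2\<close>.\<close>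
lemma Rademacher_fourth_moment:
  assumes "finite L"
  shows "(\<Sum>A\<in>Pow L. (\<Sum>l\<in>L. sgn_of A l * x l) ^ 4) \<le> 3 * 2 ^ card L * (\<Sum>l\<in>L. (x l)\<^sup>2)\<^sup>2"
  using assms
proof (induction L rule: finite_induct)
  case (insert k L)
  define X where "X A = (\<Sum>l\<in>L. sgn_of A l * x l)" for A
  define S where "S = (\<Sum>l\<in>L. (x l)\<^sup>2)"
  have X2: "(\<Sum>A\<in>Pow L. X A ^ 2) = 2 ^ card L * S"
    using Rademacher_product[OF insert.hyps(1), of x x] by (simp add: X_def S_def power2_eq_square)
  have "(\<Sum>A\<in>Pow (insert k L). (\<Sum>l\<in>insert k L. sgn_of A l * x l) ^ 4)
    = (\<Sum>A\<in>Pow L. (X A + x k) ^ 4 + (X A - x k) ^ 4)"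
    unfolding sum_Pow_insert[OF insert.hyps] X_def
    by (intro sum.cong refl) (simp add: sgn_of_sum_insert[OF insert.hyps] del: sum.insert)
  also have "\<dots> = (\<Sum>A\<in>Pow L. 2 * X A ^ 4 + 12 * (x k)\<^sup>2 * (X A)\<^sup>2 + 2 * x k ^ 4)"
    by (intro sum.cong refl) (simp add: algebra_simps power2_eq_square power4_eq_xxxx)
  also have "\<dots> = 2 * (\<Sum>A\<in>Pow L. X A ^ 4) + 12 * (x k)\<^sup>2 * (2 ^ card L * S) + 2 ^ card L * (2 * x k ^ 4)"
    by (simp add: sum.distrib sum_distrib_left[symmetric] insert.hyps card_Pow X2)
  also have "\<dots> \<le> 2 * (3 * 2 ^ card L * S\<^sup>2) + 12 * (x k)\<^sup>2 * (2 ^ card L * S) + 2 ^ card L * (6 * x k ^ 4)"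
    using insert.IH by (intro add_mono mult_left_mono) (auto simp: X_def S_def)
  also have "\<dots> = 3 * 2 ^ card (insert k L) * (\<Sum>l\<in>insert k L. (x l)\<^sup>2)\<^sup>2"
    unfolding sum.insert[OF insert.hyps] S_def[symmetric]
    using insert.hyps by (simp add: algebra_simps power2_eq_square power4_eq_xxxx)
  finally show ?case .
qed simp

lemma exp_sum_Rademacher:
  assumes "finite K"
  shows "(\<Sum>A\<in>Pow K. exp (\<Sum>k\<in>K. sgn_of A k * x k)) = (\<Prod>k\<in>K. exp (x k) + exp (- x k))"
  using assms
proof (induction K rule: finite_induct)
  case (insert k K)
  have "(\<Sum>A\<in>Pow (insert k K). exp (\<Sum>i\<in>insert k K. sgn_of A i * x i))
    = (\<Sum>A\<in>Pow K. (exp (x k) + exp (- x k)) * exp (\<Sum>i\<in>K. sgn_of A i * x i))"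
    unfolding sum_Pow_insert[OF insert.hyps]
    by (intro sum.cong refl)
      (simp add: sgn_of_sum_insert[OF insert.hyps] exp_add exp_diff exp_minus distrib_right
        divide_inverse del: sum.insert)
  then show ?case using insert by (simp add: sum_distrib_left[symmetric])
qed simp

text \<open>The sub-Gaussian bound for one sign, with exponent \<open>x\<^sup>2\<close> in place of the optimal \<open>x\<^sup>2 / 2\<close>; the weaker
  exponent follows from crude bounds separately for \<open>\<bar>x\<bar> \<le> 1\<close> and \<open>\<bar>x\<bar> > 1\<close>.\<close>
lemma cosh_le_exp_square: "exp x + exp (- x) \<le> 2 * exp (x\<^sup>2)" for x :: real
proof -
  have nonneg: "exp y + exp (- y) \<le> 2 * exp (y\<^sup>2)" if "0 \<le> y" for y :: real
  proof (cases "y \<le> 1")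
    case True
    have "1 * 1 \<le> (1 - y + y\<^sup>2) * (1 + y)"
      using that by (simp add: algebra_simps power2_eq_square)
    also have "\<dots> \<le> (1 - y + y\<^sup>2) * exp y"
      using exp_ge_add_one_self[of y] True by (intro mult_left_mono) auto
    finally have "exp (- y) \<le> 1 - y + y\<^sup>2"
      by (simp add: exp_minus field_simps)
    moreover have "exp y \<le> 1 + y + y\<^sup>2" using exp_bound[of y] that True by simp
    moreover have "1 + y\<^sup>2 \<le> exp (y\<^sup>2)" by (rule exp_ge_add_one_self)
    ultimately show ?thesis by linarith
  next
    case False
    then have "y \<le> y\<^sup>2" by (simp add: power2_eq_square)
    then have "exp y \<le> exp (y\<^sup>2)" "exp (- y) \<le> exp (y\<^sup>2)" using that False by simp_all
    then show ?thesis by linarith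
  qed
  show ?thesis
    using nonneg[of x] nonneg[of "- x"] by (cases "0 \<le> x") (auto simp: add.commute)
qed

section \<open>Contraction and symmetrization\<close>

text \<open>The core of the contraction principle, for two competing points \<open>(a, s)\<close> and \<open>(b, t)\<close> whose last
  coordinates are contracted to \<open>p\<close> and \<open>q\<close>. If the point chosen for one sign does better for
  the other sign too, only that point matters and \<open>cosh\<close> is monotone. Otherwise, if \<open>s\<close> and \<open>t\<close> have opposite
  signs, \<open>exp\<close> need only be monotone; if they have the same sign, the increments of \<open>exp\<close> at the two points
  are compared, and the larger increment starts from the larger value, where \<open>exp\<close> grows faster.\<close>
lemma exp_two_point_contraction:
  fixes a b s t p q P Q :: real
  assumes lip: "\<bar>p\<bar> \<le> \<bar>s\<bar>" "\<bar>q\<bar> \<le> \<bar>t\<bar>" "\<bar>p - q\<bar> \<le> \<bar>s - t\<bar>"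
    and P: "exp (a + s) \<le> P" "exp (b + t) \<le> P"
    and Q: "exp (a - s) \<le> Q" "exp (b - t) \<le> Q"
  shows "exp (a + p) + exp (b - q) \<le> P + Q"
proof -
  have incr: "exp (y + d) - exp y \<le> exp (z + e) - exp z"
    if "0 \<le> d" "d \<le> e" "y \<le> z" for y z d e :: real
  proof -
    have "exp y * (exp d - 1) \<le> exp z * (exp e - 1)"
      using that by (intro mult_mono) auto
    then show ?thesis by (simp add: exp_add algebra_simps)
  qed
  have same: "exp (c + h) + exp (c - h) \<le> exp (c + u) + exp (c - u)"
    if "\<bar>h\<bar> \<le> \<bar>u\<bar>" for c h u :: real
  proof -
    have "exp (c + \<bar>h\<bar>) + exp (c - \<bar>h\<bar>) \<le> exp (c + \<bar>u\<bar>) + exp (c - \<bar>u\<bar>)"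
      using incr[of "\<bar>u\<bar> - \<bar>h\<bar>" "\<bar>u\<bar> - \<bar>h\<bar>" "c - \<bar>u\<bar>" "c + \<bar>h\<bar>"] that
      by (simp add: algebra_simps)
    then show ?thesis by (auto simp: abs_if split: if_splits)
  qed
  \<comment> \<open>In the first two cases one of the points serves both signs.\<close>
  consider "a + p < b + q" | "b - q < a - p" | "b + q \<le> a + p" "a - p \<le> b - q" by linarith
  then show ?thesis
  proof cases
    case 1
    then have "exp (a + p) + exp (b - q) \<le> exp (b + q) + exp (b - q)" by simp
    then show ?thesis using same[OF lip(2), of b] P Q by linarith
  next
    case 2
    then have "exp (a + p) + exp (b - q) \<le> exp (a + p) + exp (a - p)" by simp
    then show ?thesis using same[OF lip(1), of a] P Q by linarith
  next
    case 3
    consider "0 \<le> s" "t \<le> 0" | "s \<le> 0" "0 \<le> t" | "0 \<le> s" "0 \<le> t" "t \<le> s" | "0 \<le> s" "0 \<le> t" "s \<le> t"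
      | "s \<le> 0" "t \<le> 0" "t \<le> s" | "s \<le> 0" "t \<le> 0" "s \<le> t" by linarith
    then show ?thesis
    proof cases
      case 1
      then have "exp (a + p) \<le> exp (a + s)" "exp (b - q) \<le> exp (b - t)" using lip by auto
      then show ?thesis using P Q by linarith
    next
      case 2
      then have "exp (a + p) \<le> exp (a - s)" "exp (b - q) \<le> exp (b + t)" using lip by auto
      then show ?thesis using P Q by linarith
    next
      case c: 3
      have "exp (b - q) - exp (b - t) \<le> exp (a + s) - exp (a + p)"
        using incr[of "t - q" "s - p" "b - t" "a + p"] lip c 3 by auto
      then show ?thesis using P Q by linarith
    next
      case c: 4
      have "exp (a + p) - exp (a - s) \<le> exp (b + t) - exp (b - q)"
        using incr[of "p + s" "q + t" "a - s" "b - q"] lip c 3 by auto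
      then show ?thesis using P Q by linarith
    next
      case c: 5
      have "exp (a + p) - exp (a + s) \<le> exp (b - t) - exp (b - q)"
        using incr[of "p - s" "q - t" "a + s" "b - q"] lip c 3 by auto
      then show ?thesis using P Q by linarith
    next
      case c: 6
      have "exp (b - q) - exp (b + t) \<le> exp (a - s) - exp (a + p)"
        using incr[of "- q - t" "- p - s" "b + t" "a + p"] lip c 3 by auto
      then show ?thesis using P Q by linarith
    qed
  qed
qed

lemma bdd_above_exp_image:
  fixes g :: "'f \<Rightarrow> real"
  assumes "\<And>f. f \<in> F \<Longrightarrow> g f \<le> c"
  shows "bdd_above ((\<lambda>f. exp (g f)) ` F)"
  using assms by (auto intro!: bdd_aboveI2[where M="exp c"])

lemma abs_sgn_sum_le:
  assumes "\<And>k. k \<in> K \<Longrightarrow> \<bar>x k\<bar> \<le> B"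
  shows "\<bar>\<Sum>k\<in>K. sgn_of A k * x k\<bar> \<le> real (card K) * B"
proof -
  have "\<bar>\<Sum>k\<in>K. sgn_of A k * x k\<bar> \<le> (\<Sum>k\<in>K. \<bar>x k\<bar>)"
    by (rule order_trans[OF sum_abs]) (simp add: abs_mult)
  also have "\<dots> \<le> real (card K) * B" using assms by (rule sum_bounded_above)
  finally show ?thesis .
qed

text \<open>The suprema need not be attained. Every pair of points obeys the two-point inequality with the same
  right-hand side, so the two suprema on the left can be taken one after the other.\<close>
lemma SUP_exp_contraction_step:
  fixes g p t :: "'f \<Rightarrow> real"
  assumes "F \<noteq> {}"
    and g: "\<And>f. f \<in> F \<Longrightarrow> g f \<le> G" and t: "\<And>f. f \<in> F \<Longrightarrow> \<bar>t f\<bar> \<le> B"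
    and p0: "\<And>f. f \<in> F \<Longrightarrow> \<bar>p f\<bar> \<le> \<bar>t f\<bar>"
    and p1: "\<And>f f'. f \<in> F \<Longrightarrow> f' \<in> F \<Longrightarrow> \<bar>p f - p f'\<bar> \<le> \<bar>t f - t f'\<bar>"
  shows "(SUP f\<in>F. exp (g f + p f)) + (SUP f\<in>F. exp (g f - p f))
    \<le> (SUP f\<in>F. exp (g f + t f)) + (SUP f\<in>F. exp (g f - t f))" (is "_ \<le> ?R")
proof -
  have bdd: "bdd_above ((\<lambda>f. exp (g f + t f)) ` F)" "bdd_above ((\<lambda>f. exp (g f - t f)) ` F)"
    using g t by (intro bdd_above_exp_image[of _ _ "G + B"], fastforce simp: abs_le_iff)+
  have two: "exp (g f + p f) + exp (g f' - p f') \<le> ?R" if "f \<in> F" "f' \<in> F" for f f'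
    by (rule exp_two_point_contraction[where s="t f" and t="t f'"])
      (use that in \<open>auto intro!: p0 p1 cSUP_upper bdd\<close>)
  have "exp (g f + p f) \<le> ?R - (SUP f\<in>F. exp (g f - p f))" if f: "f \<in> F" for f
  proof -
    have "(SUP f\<in>F. exp (g f - p f)) \<le> ?R - exp (g f + p f)"
      using two[OF f] by (intro cSUP_least assms(1)) (simp add: algebra_simps)
    then show ?thesis by simp
  qed
  then have "(SUP f\<in>F. exp (g f + p f)) \<le> ?R - (SUP f\<in>F. exp (g f - p f))"
    by (intro cSUP_least assms(1))
  then show ?thesis by simp
qed

text \<open>The comparison principle of Ledoux and Talagrand for the exponential function. Contracting one
  coordinate at a time leaves the others as part of the offset \<open>h\<close>, which is why an arbitrary offset
  appears in the statement.\<close>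
lemma Rademacher_contraction:
  fixes h :: "'f \<Rightarrow> real" and p t :: "'f \<Rightarrow> 'k \<Rightarrow> real"
  assumes "finite K" "F \<noteq> {}"
    and "\<And>f. f \<in> F \<Longrightarrow> h f \<le> H"
    and "\<And>f k. f \<in> F \<Longrightarrow> k \<in> K \<Longrightarrow> \<bar>t f k\<bar> \<le> B"
    and "\<And>f k. f \<in> F \<Longrightarrow> k \<in> K \<Longrightarrow> \<bar>p f k\<bar> \<le> \<bar>t f k\<bar>"
    and "\<And>f f' k. f \<in> F \<Longrightarrow> f' \<in> F \<Longrightarrow> k \<in> K \<Longrightarrow> \<bar>p f k - p f' k\<bar> \<le> \<bar>t f k - t f' k\<bar>"
  shows "(\<Sum>A\<in>Pow K. SUP f\<in>F. exp (h f + (\<Sum>k\<in>K. sgn_of A k * p f k)))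
    \<le> (\<Sum>A\<in>Pow K. SUP f\<in>F. exp (h f + (\<Sum>k\<in>K. sgn_of A k * t f k)))"
  using assms(1,3-)
proof (induction K arbitrary: h H rule: finite_induct)
  case (insert k K)
  note F = \<open>F \<noteq> {}\<close>
  note h = insert.prems(1) and t = insert.prems(2) and p0 = insert.prems(3) and p1 = insert.prems(4)
  define P where "P A f = (\<Sum>i\<in>K. sgn_of A i * p f i)" for A f
  define T where "T A f = (\<Sum>i\<in>K. sgn_of A i * t f i)" for A f
  have P_le: "\<bar>P A f\<bar> \<le> real (card K) * B" if "f \<in> F" for A f
    unfolding P_def by (intro abs_sgn_sum_le order_trans[OF p0 t]) (use that in auto)
  have split: "(\<Sum>A\<in>Pow (insert k K). SUP f\<in>F. exp (h f + (\<Sum>i\<in>insert k K. sgn_of A i * q f i)))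
     = (\<Sum>A\<in>Pow K. (SUP f\<in>F. exp (h f + q f k + (\<Sum>i\<in>K. sgn_of A i * q' f i)))
                  + (SUP f\<in>F. exp (h f - q f k + (\<Sum>i\<in>K. sgn_of A i * q' f i))))"
    if "q' = q" for q q' :: "'f \<Rightarrow> 'k \<Rightarrow> real"
    unfolding sum_Pow_insert[OF insert.hyps] that
    by (intro sum.cong refl arg_cong2[where f="(+)"] SUP_cong)
      (simp_all add: sgn_of_sum_insert[OF insert.hyps] add_ac add_diff_eq diff_add_eq del: sum.insert)
  have "(\<Sum>A\<in>Pow (insert k K). SUP f\<in>F. exp (h f + (\<Sum>i\<in>insert k K. sgn_of A i * p f i)))
     = (\<Sum>A\<in>Pow K. (SUP f\<in>F. exp (h f + P A f + p f k)) + (SUP f\<in>F. exp (h f + P A f - p f k)))"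
    unfolding split[OF refl] P_def by (simp add: algebra_simps)
  also have "\<dots> \<le> (\<Sum>A\<in>Pow K. (SUP f\<in>F. exp (h f + P A f + t f k)) + (SUP f\<in>F. exp (h f + P A f - t f k)))"
  proof (rule sum_mono)
    fix A
    have "h f + P A f \<le> H + real (card K) * B" if "f \<in> F" for f
      using h[OF that] P_le[OF that, of A] by (auto simp: abs_le_iff)
    then show "(SUP f\<in>F. exp (h f + P A f + p f k)) + (SUP f\<in>F. exp (h f + P A f - p f k))
      \<le> (SUP f\<in>F. exp (h f + P A f + t f k)) + (SUP f\<in>F. exp (h f + P A f - t f k))"
      by (rule SUP_exp_contraction_step[OF F]) (use t p0 p1 in auto)
  qed
  also have "\<dots> = (\<Sum>A\<in>Pow K. SUP f\<in>F. exp ((h f + t f k) + P A f)) + (\<Sum>A\<in>Pow K. SUP f\<in>F. exp ((h f - t f k) + P A f))"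
    by (simp add: sum.distrib algebra_simps)
  also have "\<dots> \<le> (\<Sum>A\<in>Pow K. SUP f\<in>F. exp ((h f + t f k) + T A f)) + (\<Sum>A\<in>Pow K. SUP f\<in>F. exp ((h f - t f k) + T A f))"
    unfolding P_def T_def
  proof (rule add_mono; rule insert.IH[where H="H + B"])
    show "h f + t f k \<le> H + B" "h f - t f k \<le> H + B" if "f \<in> F" for f
      using h[OF that] t[OF that, of k] by (auto simp: abs_le_iff)
  qed (use t p0 p1 in auto)
  also have "\<dots> = (\<Sum>A\<in>Pow (insert k K). SUP f\<in>F. exp (h f + (\<Sum>i\<in>insert k K. sgn_of A i * t f i)))"
    unfolding split[OF refl] T_def by (simp add: sum.distrib)
  finally show ?case .
qed simp

text \<open>By Jensen's inequality, the means may be replaced by values at an independent copy \<open>w'\<close> of the sample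
  \<open>w\<close>. The pair is exchangeable in every coordinate, so arbitrary signs can be inserted. The two
  halves of the signed sum are then separated by \<open>exp (a + b) \<le> (exp (2 a) + exp (2 b)) / 2\<close>, which
  doubles the exponent.\<close>
lemma symmetrization:
  fixes g :: "'f \<Rightarrow> 'b \<Rightarrow> real"
  assumes "finite K" "finite I" "I \<noteq> {}" "F \<noteq> {}"
    and g: "\<And>f x. f \<in> F \<Longrightarrow> x \<in> I \<Longrightarrow> \<bar>g f x\<bar> \<le> B"
  shows "2 ^ card K * (\<Sum>w\<in>K \<rightarrow>\<^sub>E I. SUP f\<in>F. exp (\<Sum>k\<in>K. g f (w k) - (\<Sum>x\<in>I. g f x) / real (card I)))
    \<le> (\<Sum>w\<in>K \<rightarrow>\<^sub>E I. \<Sum>A\<in>Pow K. SUP f\<in>F. exp (2 * (\<Sum>k\<in>K. sgn_of A k * g f (w k))))"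
proof -
  define W where "W = (K \<rightarrow>\<^sub>E I)"
  define m where "m f = (\<Sum>x\<in>I. g f x) / real (card I)" for f
  define Q where "Q A w w' = (SUP f\<in>F. exp (\<Sum>k\<in>K. sgn_of A k * (g f (w k) - g f (w' k))))" for A w w'
  define R where "R A w = (SUP f\<in>F. exp (2 * (\<Sum>k\<in>K. sgn_of A k * g f (w k))))" for A w
  have finW: "finite W" and cardW: "card W > 0"
    unfolding W_def using assms by (auto intro!: finite_PiE simp: card_gt_0_iff PiE_eq_empty_iff)
  have cardW_eq: "real (card W) = (\<Prod>k\<in>K. real (card I))"
    unfolding W_def using assms(1) by (simp add: card_PiE)
  have WI: "w k \<in> I" if "w \<in> W" "k \<in> K" for w k using that by (auto simp: W_def)
  have bddQ: "bdd_above ((\<lambda>f. exp (\<Sum>k\<in>K. sgn_of A k * (g f (w k) - g f (w' k)))) ` F)"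
    if "w \<in> W" "w' \<in> W" for A w w'
  proof (rule bdd_above_exp_image[where c="real (card K) * (2 * B)"])
    fix f assume f: "f \<in> F"
    have "\<bar>g f (w k) - g f (w' k)\<bar> \<le> 2 * B" if k: "k \<in> K" for k
      using g[OF f WI[OF \<open>w \<in> W\<close> k]] g[OF f WI[OF \<open>w' \<in> W\<close> k]] by linarith
    then show "(\<Sum>k\<in>K. sgn_of A k * (g f (w k) - g f (w' k))) \<le> real (card K) * (2 * B)"
      using abs_sgn_sum_le[of K "\<lambda>k. g f (w k) - g f (w' k)" "2 * B" A] by (auto simp: abs_le_iff)
  qed
  have bddR: "bdd_above ((\<lambda>f. exp (2 * (\<Sum>k\<in>K. sgn_of A k * g f (w k)))) ` F)" if "w \<in> W" for A w
  proof (rule bdd_above_exp_image[where c="2 * (real (card K) * B)"])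
    fix f assume f: "f \<in> F"
    show "2 * (\<Sum>k\<in>K. sgn_of A k * g f (w k)) \<le> 2 * (real (card K) * B)"
      using abs_sgn_sum_le[of K "\<lambda>k. g f (w k)" B A] g[OF f WI[OF that]] by (auto simp: abs_le_iff)
  qed
  have Jensen: "real (card I) * exp (- m f) \<le> (\<Sum>x\<in>I. exp (- g f x))" for f
  proof -
    have "real (card I) * exp (- m f) = (\<Sum>x\<in>I. exp (- m f) * (1 + (m f - g f x)))"
      using assms by (simp add: m_def sum_distrib_left[symmetric] sum.distrib sum_subtractf)
    also have "\<dots> \<le> (\<Sum>x\<in>I. exp (- m f) * exp (m f - g f x))"
      by (intro sum_mono mult_left_mono exp_ge_add_one_self) auto
    also have "\<dots> = (\<Sum>x\<in>I. exp (- g f x))" by (simp flip: exp_add)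
    finally show ?thesis .
  qed
  have ghost: "real (card W) * (SUP f\<in>F. exp (\<Sum>k\<in>K. g f (w k) - m f)) \<le> (\<Sum>w'\<in>W. Q K w w')"
    if w: "w \<in> W" for w
  proof -
    have "real (card W) * exp (\<Sum>k\<in>K. g f (w k) - m f) \<le> (\<Sum>w'\<in>W. Q K w w')" if f: "f \<in> F" for f
    proof -
      have "real (card W) * exp (\<Sum>k\<in>K. g f (w k) - m f)
          = (\<Prod>k\<in>K. exp (g f (w k)) * (real (card I) * exp (- m f)))"
        unfolding cardW_eq by (simp add: exp_sum[OF assms(1)] exp_diff exp_minus divide_inverse mult_ac prod.distrib del: prod_constant)
      also have "\<dots> \<le> (\<Prod>k\<in>K. exp (g f (w k)) * (\<Sum>x\<in>I. exp (- g f x)))"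
        by (intro prod_mono conjI mult_left_mono Jensen) auto
      also have "\<dots> = (\<Prod>k\<in>K. \<Sum>x\<in>I. exp (g f (w k) - g f x))"
        by (simp add: sum_distrib_left exp_diff exp_minus divide_inverse)
      also have "\<dots> = (\<Sum>w'\<in>W. exp (\<Sum>k\<in>K. g f (w k) - g f (w' k)))"
        unfolding W_def by (subst prod_sum_PiE) (use assms in \<open>simp_all add: exp_sum\<close>)
      also have "\<dots> \<le> (\<Sum>w'\<in>W. Q K w w')"
      proof (rule sum_mono)
        fix w' assume "w' \<in> W"
        have "(\<Sum>k\<in>K. g f (w k) - g f (w' k)) = (\<Sum>k\<in>K. sgn_of K k * (g f (w k) - g f (w' k)))"
          by (simp add: sgn_of_def)
        then show "exp (\<Sum>k\<in>K. g f (w k) - g f (w' k)) \<le> Q K w w'"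
          unfolding Q_def using cSUP_upper[OF f bddQ[OF w \<open>w' \<in> W\<close>, of K]] by simp
      qed
      finally show ?thesis .
    qed
    then have "(SUP f\<in>F. exp (\<Sum>k\<in>K. g f (w k) - m f)) \<le> (\<Sum>w'\<in>W. Q K w w') / real (card W)"
      using cardW by (intro cSUP_least assms) (simp add: field_simps)
    then show ?thesis using cardW by (simp add: field_simps)
  qed
  have swap: "(\<Sum>w\<in>W. \<Sum>w'\<in>W. Q K w w') = (\<Sum>w\<in>W. \<Sum>w'\<in>W. Q A w w')" if "A \<in> Pow K" for A
  proof -
    \<comment> \<open>Exchange the two samples at the coordinates with negative sign.\<close>
    define \<sigma> where "\<sigma> = (\<lambda>(w, w'). (\<lambda>k::'a. if k \<in> A then w k else w' k :: 'b, \<lambda>k. if k \<in> A then w' k else w k))"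
    have mem: "\<sigma> z \<in> W \<times> W" if "z \<in> W \<times> W" for z
      using that \<open>A \<in> Pow K\<close> by (auto simp: \<sigma>_def W_def PiE_def Pi_def extensional_def)
    have inv: "\<sigma> (\<sigma> z) = z" for z by (cases z) (auto simp: \<sigma>_def fun_eq_iff)
    have Q: "(case \<sigma> z of (w, w') \<Rightarrow> Q A w w') = (case z of (w, w') \<Rightarrow> Q K w w')" for z
      unfolding Q_def \<sigma>_def split_beta
      by (intro SUP_cong refl arg_cong[where f=exp] sum.cong) (auto simp: sgn_of_def)
    show ?thesis
      unfolding sum.cartesian_product
      by (rule sum.reindex_bij_witness[where i=\<sigma> and j=\<sigma>]) (use mem inv Q in auto)
  qed
  have QR: "Q A w w' \<le> (R A w + R (K - A) w') / 2" if w: "w \<in> W" "w' \<in> W" and A: "A \<in> Pow K" for A w w'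
    unfolding Q_def
  proof (rule cSUP_least[OF assms(4)])
    fix f assume f: "f \<in> F"
    define a where "a = (\<Sum>k\<in>K. sgn_of A k * g f (w k))"
    define b where "b = (\<Sum>k\<in>K. sgn_of (K - A) k * g f (w' k))"
    have "(\<Sum>k\<in>K. sgn_of A k * (g f (w k) - g f (w' k))) = a + b"
      unfolding a_def b_def using A by (subst sgn_sum_uminus) (auto simp: sum_subtractf right_diff_distrib)
    moreover have "exp (a + b) \<le> (exp (2 * a) + exp (2 * b)) / 2"
    proof -
      have "0 \<le> (exp a - exp b)\<^sup>2" by simp
      then show ?thesis by (simp add: power2_diff exp_add exp_double)
    qed
    moreover have "exp (2 * a) \<le> R A w" "exp (2 * b) \<le> R (K - A) w'"
      unfolding a_def b_def R_def using f w by (auto intro!: cSUP_upper bddR)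
    ultimately show "exp (\<Sum>k\<in>K. sgn_of A k * (g f (w k) - g f (w' k))) \<le> (R A w + R (K - A) w') / 2"
      by auto
  qed
  have "real (card W) * (2 ^ card K * (\<Sum>w\<in>W. SUP f\<in>F. exp (\<Sum>k\<in>K. g f (w k) - m f)))
      = 2 ^ card K * (\<Sum>w\<in>W. real (card W) * (SUP f\<in>F. exp (\<Sum>k\<in>K. g f (w k) - m f)))"
    by (simp add: sum_distrib_left mult_ac)
  also have "\<dots> \<le> 2 ^ card K * (\<Sum>w\<in>W. \<Sum>w'\<in>W. Q K w w')"
    by (intro mult_left_mono sum_mono ghost) auto
  also have "\<dots> = (\<Sum>A\<in>Pow K. \<Sum>w\<in>W. \<Sum>w'\<in>W. Q K w w')"
    using assms by (simp add: card_Pow)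
  also have "\<dots> = (\<Sum>A\<in>Pow K. \<Sum>w\<in>W. \<Sum>w'\<in>W. Q A w w')"
    by (intro sum.cong refl swap)
  also have "\<dots> \<le> (\<Sum>A\<in>Pow K. \<Sum>w\<in>W. \<Sum>w'\<in>W. (R A w + R (K - A) w') / 2)"
    by (intro sum_mono QR)
  also have "\<dots> = real (card W) / 2 * ((\<Sum>A\<in>Pow K. \<Sum>w\<in>W. R A w) + (\<Sum>A\<in>Pow K. \<Sum>w\<in>W. R (K - A) w))"
    by (simp add: add_divide_distrib sum.distrib sum_distrib_left sum_divide_distrib[symmetric] algebra_simps)
  also have "\<dots> = real (card W) * (\<Sum>A\<in>Pow K. \<Sum>w\<in>W. R A w)"
    using sum_Pow_complement[of "\<lambda>A. \<Sum>w\<in>W. R A w" K] by simp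
  also have "(\<Sum>A\<in>Pow K. \<Sum>w\<in>W. R A w) = (\<Sum>w\<in>W. \<Sum>A\<in>Pow K. R A w)" by (rule sum.swap)
  finally show ?thesis
    using cardW by (simp add: W_def R_def m_def)
qed

section \<open>Grothendieck's inequality\<close>

lemma sum_le_sgn_sum:
  fixes a c :: "'i \<Rightarrow> real"
  assumes "\<And>i. i \<in> I \<Longrightarrow> \<bar>a i\<bar> \<le> 1"
  shows "(\<Sum>i\<in>I. a i * c i) \<le> (\<Sum>i\<in>I. sgn_of {i\<in>I. 0 \<le> c i} i * c i)"
proof (rule sum_mono)
  fix i assume i: "i \<in> I"
  have "a i * c i \<le> \<bar>a i\<bar> * \<bar>c i\<bar>" by (metis abs_ge_self abs_mult)
  also have "\<dots> \<le> 1 * \<bar>c i\<bar>" using assms[OF i] by (intro mult_right_mono) auto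
  also have "\<dots> = sgn_of {i\<in>I. 0 \<le> c i} i * c i" using i by (auto simp: sgn_of_def)
  finally show "a i * c i \<le> sgn_of {i\<in>I. 0 \<le> c i} i * c i" .
qed

text \<open>A bilinear form on a product of cubes is largest at a pair of vertices.\<close>
lemma bilinear_le_sign_bound:
  fixes X :: "'i \<Rightarrow> 'j \<Rightarrow> real"
  assumes a: "\<And>i. i \<in> I \<Longrightarrow> \<bar>a i\<bar> \<le> 1" and b: "\<And>j. j \<in> J \<Longrightarrow> \<bar>b j\<bar> \<le> 1"
    and S: "\<And>A B. A \<subseteq> I \<Longrightarrow> B \<subseteq> J \<Longrightarrow> (\<Sum>i\<in>I. \<Sum>j\<in>J. X i j * (sgn_of A i * sgn_of B j)) \<le> S"
  shows "(\<Sum>i\<in>I. \<Sum>j\<in>J. X i j * (a i * b j)) \<le> S"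
proof -
  define A where "A = {i\<in>I. 0 \<le> (\<Sum>j\<in>J. X i j * b j)}"
  define B where "B = {j\<in>J. 0 \<le> (\<Sum>i\<in>I. X i j * sgn_of A i)}"
  have "(\<Sum>i\<in>I. \<Sum>j\<in>J. X i j * (a i * b j)) = (\<Sum>i\<in>I. a i * (\<Sum>j\<in>J. X i j * b j))"
    by (simp add: sum_distrib_left mult_ac)
  also have "\<dots> \<le> (\<Sum>i\<in>I. sgn_of A i * (\<Sum>j\<in>J. X i j * b j))"
    unfolding A_def by (rule sum_le_sgn_sum[OF a])
  also have "\<dots> = (\<Sum>j\<in>J. b j * (\<Sum>i\<in>I. X i j * sgn_of A i))"
    unfolding sum_distrib_left by (subst sum.swap) (simp add: mult_ac)
  also have "\<dots> \<le> (\<Sum>j\<in>J. sgn_of B j * (\<Sum>i\<in>I. X i j * sgn_of A i))"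
    unfolding B_def by (rule sum_le_sgn_sum[OF b])
  also have "\<dots> = (\<Sum>i\<in>I. \<Sum>j\<in>J. X i j * (sgn_of A i * sgn_of B j))"
    unfolding sum_distrib_left by (subst sum.swap) (simp add: mult_ac)
  also have "\<dots> \<le> S" by (rule S) (auto simp: A_def B_def)
  finally show ?thesis .
qed

lemma abs_inner_sum_le:
  fixes x y :: "'l \<Rightarrow> real"
  assumes "(\<Sum>l\<in>L. (x l)\<^sup>2) \<le> 1" "(\<Sum>l\<in>L. (y l)\<^sup>2) \<le> 1"
  shows "\<bar>\<Sum>l\<in>L. x l * y l\<bar> \<le> 1"
proof -
  have "\<bar>\<Sum>l\<in>L. x l * y l\<bar> \<le> (\<Sum>l\<in>L. ((x l)\<^sup>2 + (y l)\<^sup>2) / 2)"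
  proof (rule order_trans[OF sum_abs sum_mono])
    fix l
    have "0 \<le> (\<bar>x l\<bar> - \<bar>y l\<bar>)\<^sup>2" by simp
    then show "\<bar>x l * y l\<bar> \<le> ((x l)\<^sup>2 + (y l)\<^sup>2) / 2"
      by (simp add: power2_diff abs_mult)
  qed
  also have "\<dots> = ((\<Sum>l\<in>L. (x l)\<^sup>2) + (\<Sum>l\<in>L. (y l)\<^sup>2)) / 2"
    by (simp add: sum_divide_distrib sum.distrib add_divide_distrib)
  finally show ?thesis using assms by simp
qed

definition clip2 :: "real \<Rightarrow> real" where
  "clip2 x = max (-2) (min 2 x)"

lemma abs_clip2_le: "\<bar>clip2 x / 2\<bar> \<le> 1"
  by (auto simp: clip2_def)

lemma clip2_square_le: "(clip2 x)\<^sup>2 \<le> x\<^sup>2"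
  by (rule abs_le_square_iff[THEN iffD1]) (auto simp: clip2_def)

text \<open>The part of \<open>x\<close> cut off by the truncation is below a tangent parabola \<open>x\<^sup>2 / 8\<close>, so its square is
  controlled by the fourth moment.\<close>
lemma clip2_remainder_square_le: "(x - clip2 x)\<^sup>2 \<le> x ^ 4 / 64"
proof -
  have "0 \<le> (\<bar>x\<bar> - 4)\<^sup>2" by simp
  then have "\<bar>x\<bar> - 2 \<le> x\<^sup>2 / 8" by (simp add: power2_diff)
  moreover have "\<bar>x - clip2 x\<bar> = max 0 (\<bar>x\<bar> - 2)" by (auto simp: clip2_def)
  ultimately have "\<bar>x - clip2 x\<bar> \<le> \<bar>x\<^sup>2 / 8\<bar>"
    using zero_le_power2[of x] by (simp add: max_def)
  then have "(x - clip2 x)\<^sup>2 \<le> (x\<^sup>2 / 8)\<^sup>2" by (rule abs_le_square_iff[THEN iffD1])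
  then show ?thesis by (simp add: power2_eq_square power4_eq_xxxx)
qed

text \<open>Let \<open>G\<close> be the supremum of the form over all vectors of norm at most \<open>1\<close> in all dimensions; it is finite. Represent \<open>u\<^sub>i\<close> and \<open>v\<^sub>j\<close> by the
  Rademacher sums \<open>x\<^sub>i\<close> and \<open>y\<^sub>j\<close>, whose average product over the signs is the inner product of \<open>u\<^sub>i\<close> and
  \<open>v\<^sub>j\<close>. Truncating both at \<open>2\<close> gives a bilinear form in bounded scalars, worth at most \<open>4 S\<close>. By the
  fourth moment bound, each remainder has \<open>L\<^sup>2\<close> norm at most \<open>1/4\<close>, and the two correction terms are
  again sums of the original form, now over the signs as coordinates; they are worth at most \<open>G / 4\<close>
  each. Hence \<open>G \<le> 4 S + G / 2\<close>.\<close>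
theorem Grothendieck_inequality:
  fixes X :: "'i \<Rightarrow> 'j \<Rightarrow> real" and u :: "'i \<Rightarrow> nat \<Rightarrow> real" and v :: "'j \<Rightarrow> nat \<Rightarrow> real"
  assumes "finite L"
    and u: "\<And>i. i \<in> I \<Longrightarrow> (\<Sum>l\<in>L. (u i l)\<^sup>2) \<le> 1" and v: "\<And>j. j \<in> J \<Longrightarrow> (\<Sum>l\<in>L. (v j l)\<^sup>2) \<le> 1"
    and S: "\<And>A B. A \<subseteq> I \<Longrightarrow> B \<subseteq> J \<Longrightarrow> (\<Sum>i\<in>I. \<Sum>j\<in>J. X i j * (sgn_of A i * sgn_of B j)) \<le> S"
  shows "(\<Sum>i\<in>I. \<Sum>j\<in>J. X i j * (\<Sum>l\<in>L. u i l * v j l)) \<le> 8 * S"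
proof -
  define valid where "valid = (\<lambda>L u v. finite (L :: nat set) \<and> (\<forall>i\<in>I. (\<Sum>l\<in>L. (u i l)\<^sup>2) \<le> (1::real))
    \<and> (\<forall>j\<in>J. (\<Sum>l\<in>L. (v j l)\<^sup>2) \<le> (1::real)))"
  define val where "val = (\<lambda>(L :: nat set) u v. \<Sum>i\<in>I. \<Sum>j\<in>J. X i j * (\<Sum>l\<in>L. u i l * v j l))"
  define V where "V = {val L u v |L u v. valid L u v}"
  define G where "G = Sup V"
  have "val L u v \<le> (\<Sum>i\<in>I. \<Sum>j\<in>J. \<bar>X i j\<bar>)" if "valid L u v" for L u v
    unfolding val_def
  proof (intro sum_mono)
    fix i j assume "i \<in> I" "j \<in> J"
    then have le: "\<bar>\<Sum>l\<in>L. u i l * v j l\<bar> \<le> 1"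
      using that by (intro abs_inner_sum_le) (auto simp: valid_def)
    have "X i j * (\<Sum>l\<in>L. u i l * v j l) \<le> \<bar>X i j\<bar> * \<bar>\<Sum>l\<in>L. u i l * v j l\<bar>"
      by (metis abs_ge_self abs_mult)
    also have "\<dots> \<le> \<bar>X i j\<bar> * 1" using le by (intro mult_left_mono) auto
    finally show "X i j * (\<Sum>l\<in>L. u i l * v j l) \<le> \<bar>X i j\<bar>" by simp
  qed
  then have bdd: "bdd_above V" by (auto simp: V_def bdd_above_def)
  have val_le: "val L u v \<le> G" if "valid L u v" for L u v
    unfolding G_def using that by (intro cSup_upper bdd) (auto simp: V_def)
  \<comment> \<open>Coordinates may be indexed by sign patterns, up to an enumeration of them.\<close>
  have scaled: "(\<Sum>i\<in>I. \<Sum>j\<in>J. X i j * (\<Sum>A\<in>P. x i A * y j A)) \<le> \<alpha> * \<beta> * G"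
    if P: "finite P" and pos: "0 < \<alpha>" "0 < \<beta>"
      and x: "\<And>i. i \<in> I \<Longrightarrow> (\<Sum>A\<in>P. (x i A)\<^sup>2) \<le> \<alpha>\<^sup>2" and y: "\<And>j. j \<in> J \<Longrightarrow> (\<Sum>A\<in>P. (y j A)\<^sup>2) \<le> \<beta>\<^sup>2"
    for P :: "nat set set" and x y \<alpha> \<beta>
  proof -
    obtain h where h: "bij_betw h {0..<card P} P" using ex_bij_betw_nat_finite[OF P] by blast
    note re = sum.reindex_bij_betw[OF h]
    have "valid {0..<card P} (\<lambda>i l. x i (h l) / \<alpha>) (\<lambda>j l. y j (h l) / \<beta>)"
      unfolding valid_def power_divide sum_divide_distrib[symmetric] 
        re[of "\<lambda>A. (x _ A)\<^sup>2"] re[of "\<lambda>A. (y _ A)\<^sup>2"]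
      using pos x y by auto
    from val_le[OF this] have "(\<Sum>i\<in>I. \<Sum>j\<in>J. X i j * ((\<Sum>A\<in>P. x i A * y j A) / (\<alpha> * \<beta>))) \<le> G"
      unfolding val_def times_divide_times_eq sum_divide_distrib[symmetric] re[of "\<lambda>A. x _ A * y _ A"] .
    then have "(\<Sum>i\<in>I. \<Sum>j\<in>J. X i j * (\<Sum>A\<in>P. x i A * y j A)) / (\<alpha> * \<beta>) \<le> G"
      by (simp flip: sum_divide_distrib)
    then show ?thesis using pos by (simp add: field_simps)
  qed
  have step: "val L u v \<le> 4 * S + G / 2" if "valid L u v" for L u v
  proof -
    have L: "finite L" and u: "\<And>i. i \<in> I \<Longrightarrow> (\<Sum>l\<in>L. (u i l)\<^sup>2) \<le> 1" and v: "\<And>j. j \<in> J \<Longrightarrow> (\<Sum>l\<in>L. (v j l)\<^sup>2) \<le> 1"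
      using that by (auto simp: valid_def)
    define N :: real where "N = 2 ^ card L"
    define x where "x i A = (\<Sum>l\<in>L. sgn_of A l * u i l)" for i A
    define y where "y j A = (\<Sum>l\<in>L. sgn_of A l * v j l)" for j A
    have N: "N > 0" by (simp add: N_def)
    have sq: "(\<Sum>A\<in>Pow L. (\<Sum>l\<in>L. sgn_of A l * z l)\<^sup>2) \<le> (sqrt N)\<^sup>2"
      and sq_clip: "(\<Sum>A\<in>Pow L. (clip2 (\<Sum>l\<in>L. sgn_of A l * z l))\<^sup>2) \<le> (sqrt N)\<^sup>2"
      and sq_rem: "(\<Sum>A\<in>Pow L. ((\<Sum>l\<in>L. sgn_of A l * z l) - clip2 (\<Sum>l\<in>L. sgn_of A l * z l))\<^sup>2) \<le> (sqrt N / 4)\<^sup>2"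
      if z: "(\<Sum>l\<in>L. (z l)\<^sup>2) \<le> 1" for z :: "nat \<Rightarrow> real"
    proof -
      have "(\<Sum>A\<in>Pow L. (\<Sum>l\<in>L. sgn_of A l * z l)\<^sup>2) = N * (\<Sum>l\<in>L. (z l)\<^sup>2)"
        using Rademacher_product[OF L, of z z] by (simp add: N_def power2_eq_square)
      also have "\<dots> \<le> N * 1" using z N by (intro mult_left_mono) auto
      finally show *: "(\<Sum>A\<in>Pow L. (\<Sum>l\<in>L. sgn_of A l * z l)\<^sup>2) \<le> (sqrt N)\<^sup>2" using N by simp
      then show "(\<Sum>A\<in>Pow L. (clip2 (\<Sum>l\<in>L. sgn_of A l * z l))\<^sup>2) \<le> (sqrt N)\<^sup>2"
        by (rule order_trans[rotated]) (intro sum_mono clip2_square_le)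
      have "(\<Sum>A\<in>Pow L. ((\<Sum>l\<in>L. sgn_of A l * z l) - clip2 (\<Sum>l\<in>L. sgn_of A l * z l))\<^sup>2)
         \<le> (\<Sum>A\<in>Pow L. (\<Sum>l\<in>L. sgn_of A l * z l) ^ 4 / 64)"
        by (intro sum_mono clip2_remainder_square_le)
      also have "\<dots> \<le> 3 * N * (\<Sum>l\<in>L. (z l)\<^sup>2)\<^sup>2 / 64"
        using Rademacher_fourth_moment[OF L, of z] by (simp add: sum_divide_distrib[symmetric] N_def)
      also have "\<dots> \<le> 3 * N * 1 / 64"
        using z N by (intro divide_right_mono mult_left_mono power_le_one sum_nonneg) auto
      also have "\<dots> \<le> (sqrt N / 4)\<^sup>2" using N by (simp add: power_divide)
      finally show "(\<Sum>A\<in>Pow L. ((\<Sum>l\<in>L. sgn_of A l * z l) - clip2 (\<Sum>l\<in>L. sgn_of A l * z l))\<^sup>2) \<le> (sqrt N / 4)\<^sup>2" .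
    qed
    define T1 where "T1 = (\<Sum>i\<in>I. \<Sum>j\<in>J. X i j * (\<Sum>A\<in>Pow L. clip2 (x i A) * clip2 (y j A)))"
    define T2 where "T2 = (\<Sum>i\<in>I. \<Sum>j\<in>J. X i j * (\<Sum>A\<in>Pow L. (x i A - clip2 (x i A)) * y j A))"
    define T3 where "T3 = (\<Sum>i\<in>I. \<Sum>j\<in>J. X i j * (\<Sum>A\<in>Pow L. clip2 (x i A) * (y j A - clip2 (y j A))))"
    have "N * val L u v = (\<Sum>i\<in>I. \<Sum>j\<in>J. X i j * (\<Sum>A\<in>Pow L. x i A * y j A))"
      unfolding val_def x_def y_def Rademacher_product[OF L] N_def by (simp add: sum_distrib_left mult_ac)
    also have "\<dots> = T1 + T2 + T3"
      unfolding T1_def T2_def T3_def sum.distrib[symmetric] distrib_left[symmetric]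
      by (intro sum.cong refl arg_cong2[where f="(*)"]) (simp add: algebra_simps)
    finally have "N * val L u v = T1 + T2 + T3" .
    moreover have "T1 \<le> N * (4 * S)"
    proof -
      have "T1 = (\<Sum>i\<in>I. \<Sum>j\<in>J. \<Sum>A\<in>Pow L. 4 * (X i j * (clip2 (x i A) / 2 * (clip2 (y j A) / 2))))"
        unfolding T1_def by (simp add: sum_distrib_left)
      also have "\<dots> = (\<Sum>i\<in>I. \<Sum>A\<in>Pow L. \<Sum>j\<in>J. 4 * (X i j * (clip2 (x i A) / 2 * (clip2 (y j A) / 2))))"
        by (intro sum.cong refl sum.swap)
      also have "\<dots> = (\<Sum>A\<in>Pow L. \<Sum>i\<in>I. \<Sum>j\<in>J. 4 * (X i j * (clip2 (x i A) / 2 * (clip2 (y j A) / 2))))"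
        by (rule sum.swap)
      also have "\<dots> = (\<Sum>A\<in>Pow L. 4 * (\<Sum>i\<in>I. \<Sum>j\<in>J. X i j * (clip2 (x i A) / 2 * (clip2 (y j A) / 2))))"
        unfolding sum_distrib_left ..
      also have "\<dots> \<le> (\<Sum>A\<in>Pow L. 4 * S)"
        by (intro sum_mono mult_left_mono, rule bilinear_le_sign_bound)
          (use abs_clip2_le S in auto)
      finally show ?thesis using L by (simp add: N_def card_Pow)
    qed
    moreover have "T2 \<le> sqrt N / 4 * sqrt N * G"
      unfolding T2_def x_def y_def using N L by (intro scaled sq sq_rem u v) auto
    moreover have "T3 \<le> sqrt N * (sqrt N / 4) * G"
      unfolding T3_def x_def y_def using N L by (intro scaled sq_clip sq_rem u v) auto
    ultimately have "N * val L u v \<le> N * (4 * S) + N / 4 * G + N / 4 * G"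
      using N by (simp add: algebra_simps)
    also have "\<dots> = N * (4 * S + G / 2)" by (simp add: algebra_simps)
    finally show ?thesis using N by simp
  qed
  have here: "valid L u v" using assms by (simp add: valid_def)
  have "G \<le> 4 * S + G / 2"
    unfolding G_def by (rule cSup_least) (use step here in \<open>auto simp: V_def G_def\<close>)
  with val_le[OF here] show ?thesis by (simp add: val_def)
qed

corollary Grothendieck_inequality_scaled:
  fixes X :: "'i \<Rightarrow> 'j \<Rightarrow> real" and u :: "'i \<Rightarrow> nat \<Rightarrow> real" and v :: "'j \<Rightarrow> nat \<Rightarrow> real"
  assumes L: "finite L" and nonneg: "0 \<le> \<alpha>" "0 \<le> \<beta>"
    and u: "\<And>i. i \<in> I \<Longrightarrow> (\<Sum>l\<in>L. (u i l)\<^sup>2) \<le> \<alpha>\<^sup>2" and v: "\<And>j. j \<in> J \<Longrightarrow> (\<Sum>l\<in>L. (v j l)\<^sup>2) \<le> \<beta>\<^sup>2"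
    and S: "\<And>A B. A \<subseteq> I \<Longrightarrow> B \<subseteq> J \<Longrightarrow> (\<Sum>i\<in>I. \<Sum>j\<in>J. X i j * (sgn_of A i * sgn_of B j)) \<le> S"
  shows "(\<Sum>i\<in>I. \<Sum>j\<in>J. X i j * (\<Sum>l\<in>L. u i l * v j l)) \<le> \<alpha> * \<beta> * (8 * S)"
proof (cases "\<alpha> = 0 \<or> \<beta> = 0")
  case True
  have "X i j * (\<Sum>l\<in>L. u i l * v j l) = 0" if ij: "i \<in> I" "j \<in> J" for i j
  proof -
    have "(\<Sum>l\<in>L. (u i l)\<^sup>2) = 0 \<or> (\<Sum>l\<in>L. (v j l)\<^sup>2) = 0"
      using True u[OF ij(1)] v[OF ij(2)] sum_nonneg[of L "\<lambda>l. (u i l)\<^sup>2"] sum_nonneg[of L "\<lambda>l. (v j l)\<^sup>2"]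
      by auto
    then have "(\<forall>l\<in>L. u i l = 0) \<or> (\<forall>l\<in>L. v j l = 0)"
      using L by (simp add: sum_nonneg_eq_0_iff)
    then show ?thesis by (auto simp: sum.neutral)
  qed
  then have "(\<Sum>i\<in>I. \<Sum>j\<in>J. X i j * (\<Sum>l\<in>L. u i l * v j l)) = 0" by (simp add: sum.neutral)
  then show ?thesis using True by auto
next
  case False
  then have pos: "0 < \<alpha>" "0 < \<beta>" using nonneg by auto
  have "(\<Sum>i\<in>I. \<Sum>j\<in>J. X i j * (\<Sum>l\<in>L. u i l / \<alpha> * (v j l / \<beta>))) \<le> 8 * S"
    by (rule Grothendieck_inequality[OF L _ _ S])
      (use pos u v in \<open>auto simp: power_divide sum_divide_distrib[symmetric]\<close>)
  then have "(\<Sum>i\<in>I. \<Sum>j\<in>J. X i j * (\<Sum>l\<in>L. u i l * v j l)) / (\<alpha> * \<beta>) \<le> 8 * S"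
    by (simp add: sum_divide_distrib[symmetric])
  then show ?thesis using pos by (simp add: field_simps)
qed

section \<open>Concentration for factorizable functions\<close>

text \<open>On \<open>I \<times> J\<close>, the function is a matrix product \<open>U V\<^sup>T\<close> with row norms at most \<open>\<alpha>\<close> and \<open>\<beta>\<close>, where
  \<open>\<alpha> \<beta> \<le> R\<close>: a max-norm bound with an attained factorization.\<close>
definition factors_within :: "real \<Rightarrow> 'i set \<Rightarrow> 'j set \<Rightarrow> ('i \<times> 'j \<Rightarrow> real) \<Rightarrow> bool" where
  "factors_within R I J f \<longleftrightarrow> (\<exists>(L :: nat set) u v \<alpha> \<beta>. finite L \<and> 0 \<le> \<alpha> \<and> 0 \<le> \<beta> \<and> \<alpha> * \<beta> \<le> R \<and>
     (\<forall>i\<in>I. (\<Sum>l\<in>L. (u i l)\<^sup>2) \<le> \<alpha>\<^sup>2) \<and> (\<forall>j\<in>J. (\<Sum>l\<in>L. (v j l)\<^sup>2) \<le> \<beta>\<^sup>2) \<and>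
     (\<forall>i\<in>I. \<forall>j\<in>J. f (i, j) = (\<Sum>l\<in>L. u i l * v j l)))"

definition sign_product :: "'i set \<times> 'j set \<Rightarrow> 'i \<times> 'j \<Rightarrow> real" where
  "sign_product AB p = sgn_of (fst AB) (fst p) * sgn_of (snd AB) (snd p)"

text \<open>Grouping the samples by position turns the signed sum into a bilinear pairing with \<open>f\<close>, to which
  Grothendieck's inequality applies. The maximum over sign products is then bounded by the sum, at the
  price of the number of sign patterns in the exponential moment.\<close>
lemma exp_le_sum_sign_products:
  fixes w :: "'k \<Rightarrow> 'i \<times> 'j"
  assumes fin: "finite K" "finite I" "finite J"
    and w: "\<And>k. k \<in> K \<Longrightarrow> w k \<in> I \<times> J"
    and f: "factors_within R I J f" and "0 \<le> \<mu>"
  shows "exp (\<mu> * (\<Sum>k\<in>K. c k * f (w k)))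
    \<le> (\<Sum>AB\<in>Pow I \<times> Pow J. exp (8 * R * \<mu> * (\<Sum>k\<in>K. c k * sign_product AB (w k))))"
proof -
  obtain L :: "nat set" and u v \<alpha> \<beta> where L: "finite L" and pos: "0 \<le> \<alpha>" "0 \<le> \<beta>" "\<alpha> * \<beta> \<le> R"
    and u: "\<And>i. i \<in> I \<Longrightarrow> (\<Sum>l\<in>L. (u i l)\<^sup>2) \<le> \<alpha>\<^sup>2" and v: "\<And>j. j \<in> J \<Longrightarrow> (\<Sum>l\<in>L. (v j l)\<^sup>2) \<le> \<beta>\<^sup>2"
    and uv: "\<And>i j. i \<in> I \<Longrightarrow> j \<in> J \<Longrightarrow> f (i, j) = (\<Sum>l\<in>L. u i l * v j l)"
    using f unfolding factors_within_def by blast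
  define X where "X i j = (\<Sum>k\<in>{k\<in>K. w k = (i, j)}. c k)" for i j
  have group: "(\<Sum>k\<in>K. c k * q (w k)) = (\<Sum>i\<in>I. \<Sum>j\<in>J. X i j * q (i, j))" for q
  proof -
    have "(\<Sum>k\<in>K. c k * q (w k)) = (\<Sum>p\<in>I \<times> J. \<Sum>k\<in>{k\<in>K. w k = p}. c k * q (w k))"
      by (rule sum.group[symmetric]) (use fin w in blast)+
    also have "\<dots> = (\<Sum>p\<in>I \<times> J. (\<Sum>k\<in>{k\<in>K. w k = p}. c k) * q p)"
      by (simp add: sum_distrib_right)
    finally show ?thesis unfolding X_def by (simp add: sum.cartesian_product split_beta)
  qed
  define s where "s AB = (\<Sum>k\<in>K. c k * sign_product AB (w k))" for AB
  define S where "S = Max (s ` (Pow I \<times> Pow J))"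
  have fin_s: "finite (s ` (Pow I \<times> Pow J))" using fin by simp
  have sign_le: "(\<Sum>i\<in>I. \<Sum>j\<in>J. X i j * (sgn_of A i * sgn_of B j)) \<le> S" if "A \<subseteq> I" "B \<subseteq> J" for A B
  proof -
    have "(\<Sum>i\<in>I. \<Sum>j\<in>J. X i j * (sgn_of A i * sgn_of B j)) = s (A, B)"
      unfolding s_def group by (simp add: sign_product_def)
    also have "\<dots> \<le> S" unfolding S_def using that by (intro Max_ge fin_s) auto
    finally show ?thesis .
  qed
  obtain AB where AB: "AB \<in> Pow I \<times> Pow J" "S = s AB"
    using Max_in[OF fin_s] unfolding S_def by fastforce
  \<comment> \<open>Grothendieck's inequality for zero vectors.\<close>
  have "0 \<le> S"
    using Grothendieck_inequality[of "{}" I "\<lambda>_ _. 0" J "\<lambda>_ _. 0" X S, OF _ _ _ sign_le] by simp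
  have "(\<Sum>k\<in>K. c k * f (w k)) = (\<Sum>i\<in>I. \<Sum>j\<in>J. X i j * (\<Sum>l\<in>L. u i l * v j l))"
    unfolding group by (simp add: uv)
  also have "\<dots> \<le> \<alpha> * \<beta> * (8 * S)"
    by (rule Grothendieck_inequality_scaled[OF L pos(1,2) u v sign_le])
  also have "\<dots> \<le> R * (8 * S)" using pos \<open>0 \<le> S\<close> by (intro mult_right_mono) auto
  finally have "\<mu> * (\<Sum>k\<in>K. c k * f (w k)) \<le> \<mu> * (R * (8 * S))"
    by (rule mult_left_mono) fact
  then have "exp (\<mu> * (\<Sum>k\<in>K. c k * f (w k))) \<le> exp (8 * R * \<mu> * s AB)"
    by (simp add: AB(2) mult_ac)
  also have "\<dots> \<le> (\<Sum>AB\<in>Pow I \<times> Pow J. exp (8 * R * \<mu> * s AB))"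
    by (rule member_le_sum) (use AB fin in auto)
  finally show ?thesis unfolding s_def .
qed

text \<open>The sign of \<open>\<theta>\<close> selects deviations above or below the mean. The contraction compares
  \<open>2 \<theta> t\<^sup>2\<close> with \<open>4 \<tau> t\<close> on \<open>[-1, 1]\<close>, and Grothendieck's constant \<open>8\<close> raises the factor to \<open>32\<close>.\<close>
lemma exp_moment_bound:
  fixes F :: "('i \<times> 'j \<Rightarrow> real) set" and K :: "'k set"
  assumes fin: "finite K" "finite I" "finite J" and ne: "I \<noteq> {}" "J \<noteq> {}" "F \<noteq> {}"
    and F1: "\<And>f p. f \<in> F \<Longrightarrow> p \<in> I \<times> J \<Longrightarrow> \<bar>f p\<bar> \<le> 1"
    and FR: "\<And>f. f \<in> F \<Longrightarrow> factors_within R I J f"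
    and \<theta>: "\<bar>\<theta>\<bar> = \<tau>"
  shows "(\<Sum>w\<in>K \<rightarrow>\<^sub>E I \<times> J. SUP f\<in>F. exp (\<Sum>k\<in>K. \<theta> * (f (w k))\<^sup>2 - (\<Sum>p\<in>I \<times> J. \<theta> * (f p)\<^sup>2) / real (card (I \<times> J))))
    \<le> real (card (K \<rightarrow>\<^sub>E I \<times> J)) * (2 ^ (card I + card J) * exp (real (card K) * (32 * \<tau> * R)\<^sup>2))"
    (is "?E \<le> _")
proof -
  define W where "W = (K \<rightarrow>\<^sub>E I \<times> J)"
  define C where "C = exp ((32 * \<tau> * R)\<^sup>2)"
  have \<tau>: "0 \<le> \<tau>" using \<theta> by auto
  have sq1: "(f p)\<^sup>2 \<le> 1" if "f \<in> F" "p \<in> I \<times> J" for f p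
    using F1[OF that] by (simp add: abs_square_le_1)
  have average: "(\<Sum>A\<in>Pow K. SUP f\<in>F. exp (2 * (\<Sum>k\<in>K. sgn_of A k * (\<theta> * (f (w k))\<^sup>2))))
    \<le> 2 ^ card K * (2 ^ (card I + card J) * C ^ card K)" if w: "w \<in> W" for w
  proof -
    have wk: "w k \<in> I \<times> J" if "k \<in> K" for k using w that unfolding W_def by (rule PiE_mem)
    define E where "E A AB = (\<Sum>k\<in>K. sgn_of A k * (32 * \<tau> * R * sign_product AB (w k)))" for A AB
    have "(\<Sum>A\<in>Pow K. SUP f\<in>F. exp (2 * (\<Sum>k\<in>K. sgn_of A k * (\<theta> * (f (w k))\<^sup>2))))
        = (\<Sum>A\<in>Pow K. SUP f\<in>F. exp (0 + (\<Sum>k\<in>K. sgn_of A k * (2 * \<theta> * (f (w k))\<^sup>2))))"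
      by (simp add: sum_distrib_left mult_ac)
    also have "\<dots> \<le> (\<Sum>A\<in>Pow K. SUP f\<in>F. exp (0 + (\<Sum>k\<in>K. sgn_of A k * (4 * \<tau> * f (w k)))))"
    proof (rule Rademacher_contraction[OF fin(1) ne(3), where H=0 and B="4 * \<tau>"])
      fix f k assume fk: "f \<in> F" "k \<in> K"
      note f1 = F1[OF fk(1) wk[OF fk(2)]]
      show "\<bar>4 * \<tau> * f (w k)\<bar> \<le> 4 * \<tau>"
        using f1 \<tau> by (simp add: abs_mult mult_left_le)
      have "\<bar>2 * \<theta> * (f (w k))\<^sup>2\<bar> = 2 * \<tau> * \<bar>f (w k)\<bar> * \<bar>f (w k)\<bar>"
        using \<theta> by (simp add: abs_mult power2_eq_square)
      also have "\<dots> \<le> 2 * \<tau> * \<bar>f (w k)\<bar> * 2" using f1 \<tau> by (intro mult_left_mono) auto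
      also have "\<dots> = \<bar>4 * \<tau> * f (w k)\<bar>" using \<tau> by (simp add: abs_mult)
      finally show "\<bar>2 * \<theta> * (f (w k))\<^sup>2\<bar> \<le> \<bar>4 * \<tau> * f (w k)\<bar>" .
    next
      fix f g k assume fk: "f \<in> F" "g \<in> F" "k \<in> K"
      note f1 = F1[OF fk(1) wk[OF fk(3)]] and g1 = F1[OF fk(2) wk[OF fk(3)]]
      have "2 * \<theta> * (f (w k))\<^sup>2 - 2 * \<theta> * (g (w k))\<^sup>2 = 2 * \<theta> * (f (w k) - g (w k)) * (f (w k) + g (w k))"
        by (simp add: power2_eq_square algebra_simps)
      then have "\<bar>2 * \<theta> * (f (w k))\<^sup>2 - 2 * \<theta> * (g (w k))\<^sup>2\<bar>
          = 2 * \<tau> * \<bar>f (w k) - g (w k)\<bar> * \<bar>f (w k) + g (w k)\<bar>"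
        using \<theta> by (simp add: abs_mult)
      also have "\<dots> \<le> 2 * \<tau> * \<bar>f (w k) - g (w k)\<bar> * 2"
        using f1 g1 \<tau> by (intro mult_left_mono) auto
      also have "\<dots> = \<bar>4 * \<tau> * (f (w k) - g (w k))\<bar>" using \<tau> by (simp add: abs_mult)
      finally show "\<bar>2 * \<theta> * (f (w k))\<^sup>2 - 2 * \<theta> * (g (w k))\<^sup>2\<bar> \<le> \<bar>4 * \<tau> * f (w k) - 4 * \<tau> * g (w k)\<bar>"
        by (simp add: right_diff_distrib)
    qed simp
    also have "\<dots> \<le> (\<Sum>A\<in>Pow K. \<Sum>AB\<in>Pow I \<times> Pow J. exp (E A AB))"
    proof (intro sum_mono cSUP_least ne(3))
      fix A f assume "f \<in> F"
      have "exp (4 * \<tau> * (\<Sum>k\<in>K. sgn_of A k * f (w k)))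
         \<le> (\<Sum>AB\<in>Pow I \<times> Pow J. exp (8 * R * (4 * \<tau>) * (\<Sum>k\<in>K. sgn_of A k * sign_product AB (w k))))"
        using \<tau> by (intro exp_le_sum_sign_products fin wk FR \<open>f \<in> F\<close>) auto
      then show "exp (0 + (\<Sum>k\<in>K. sgn_of A k * (4 * \<tau> * f (w k)))) \<le> (\<Sum>AB\<in>Pow I \<times> Pow J. exp (E A AB))"
        by (simp add: E_def sum_distrib_left mult_ac)
    qed
    also have "\<dots> = (\<Sum>AB\<in>Pow I \<times> Pow J. \<Sum>A\<in>Pow K. exp (E A AB))" by (rule sum.swap)
    also have "\<dots> \<le> (\<Sum>AB\<in>Pow I \<times> Pow J. \<Prod>k\<in>K. 2 * C)"
      unfolding E_def exp_sum_Rademacher[OF fin(1)]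
    proof (intro sum_mono prod_mono conjI)
      fix AB k
      have "\<bar>sign_product AB (w k)\<bar> = 1" by (simp add: sign_product_def abs_mult)
      then have "(sign_product AB (w k))\<^sup>2 = 1" by (simp add: abs_square_eq_1)
      then show "exp (32 * \<tau> * R * sign_product AB (w k)) + exp (- (32 * \<tau> * R * sign_product AB (w k))) \<le> 2 * C"
        using cosh_le_exp_square[of "32 * \<tau> * R * sign_product AB (w k)"]
        by (simp add: C_def power_mult_distrib)
    qed (simp add: add_nonneg_nonneg)
    also have "\<dots> = 2 ^ card K * (2 ^ (card I + card J) * C ^ card K)"
      using fin by (simp add: card_cartesian_product card_Pow power_add power_mult_distrib)
    finally show ?thesis .
  qed
  have "2 ^ card K * ?E \<le> (\<Sum>w\<in>W. \<Sum>A\<in>Pow K. SUP f\<in>F. exp (2 * (\<Sum>k\<in>K. sgn_of A k * (\<theta> * (f (w k))\<^sup>2))))"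
    unfolding W_def
  proof (rule symmetrization[OF fin(1) _ _ ne(3), where B=\<tau>])
    fix f p assume "f \<in> F" "p \<in> I \<times> J"
    then show "\<bar>\<theta> * (f p)\<^sup>2\<bar> \<le> \<tau>" using sq1[of f p] \<tau> \<theta> by (simp add: abs_mult mult_left_le)
  qed (use fin ne in auto)
  also have "\<dots> \<le> (\<Sum>w\<in>W. 2 ^ card K * (2 ^ (card I + card J) * C ^ card K))"
    by (intro sum_mono average)
  finally have "2 ^ card K * ?E \<le> 2 ^ card K * (real (card W) * (2 ^ (card I + card J) * C ^ card K))"
    by (simp add: mult_ac)
  then have "?E \<le> real (card W) * (2 ^ (card I + card J) * C ^ card K)" by simp
  then show ?thesis unfolding W_def C_def exp_of_nat_mult .
qed

definition mean_square :: "('p \<Rightarrow> real) \<Rightarrow> 'p set \<Rightarrow> real" where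
  "mean_square f P = (\<Sum>p\<in>P. (f p)\<^sup>2) / real (card P)"

text \<open>Markov's inequality at the parameter \<open>\<tau> = sqrt (Y / n) / R\<close>, which balances the level of the deviation
  against the variance term: the latter becomes \<open>1024 Y\<close>, the former \<open>1025 Y\<close>, leaving \<open>exp (- Y)\<close>.\<close>
lemma few_deviating_samples:
  fixes F :: "('i \<times> 'j \<Rightarrow> real) set" and K :: "'k set"
  assumes fin: "finite K" "finite I" "finite J" and ne: "K \<noteq> {}" "I \<noteq> {}" "J \<noteq> {}" "F \<noteq> {}"
    and F1: "\<And>f p. f \<in> F \<Longrightarrow> p \<in> I \<times> J \<Longrightarrow> \<bar>f p\<bar> \<le> 1"
    and FR: "\<And>f. f \<in> F \<Longrightarrow> factors_within R I J f"
    and R: "0 < R" and Y: "0 < Y"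
  shows "real (card {w \<in> K \<rightarrow>\<^sub>E I \<times> J. \<exists>f\<in>F.
      1025 * R * sqrt (Y / real (card K)) < \<bar>(\<Sum>k\<in>K. (f (w k))\<^sup>2) / real (card K) - mean_square f (I \<times> J)\<bar>})
    \<le> real (card (K \<rightarrow>\<^sub>E I \<times> J)) * (2 ^ (card I + card J + 1) * exp (- Y))"
proof -
  define W where "W = (K \<rightarrow>\<^sub>E I \<times> J)"
  define n where "n = real (card K)"
  define \<tau> where "\<tau> = sqrt (Y / n) / R"
  define D where "D \<theta> f w = (\<Sum>k\<in>K. \<theta> * (f (w k))\<^sup>2 - (\<Sum>p\<in>I \<times> J. \<theta> * (f p)\<^sup>2) / real (card (I \<times> J)))"
    for \<theta> and f :: "'i \<times> 'j \<Rightarrow> real" and w :: "'k \<Rightarrow> 'i \<times> 'j"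
  define bad where "bad \<theta> = {w\<in>W. \<exists>f\<in>F. 1025 * Y < D \<theta> f w}" for \<theta>
  have n: "0 < n" unfolding n_def using fin ne by (simp add: card_gt_0_iff)
  have \<tau>: "0 < \<tau>" unfolding \<tau>_def using n R Y by simp
  have finW: "finite W" unfolding W_def using fin by (intro finite_PiE) auto
  have D_eq: "D \<theta> f w = n * (\<theta> * ((\<Sum>k\<in>K. (f (w k))\<^sup>2) / n - mean_square f (I \<times> J)))" for \<theta> f w
    unfolding D_def mean_square_def using n
    by (simp add: sum_subtractf sum_distrib_left[symmetric] n_def field_simps)
  have level: "n * (\<tau> * (1025 * R * sqrt (Y / n))) = 1025 * Y"
    unfolding \<tau>_def using n R Y by (simp add: field_simps)
  have variance: "n * (32 * \<tau> * R)\<^sup>2 = 1024 * Y"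
    unfolding \<tau>_def using n R Y by (simp add: power_mult_distrib power_divide)
  have moment: "(\<Sum>w\<in>W. SUP f\<in>F. exp (D \<theta> f w)) \<le> real (card W) * (2 ^ (card I + card J) * exp (1024 * Y))"
    if "\<bar>\<theta>\<bar> = \<tau>" for \<theta>
  proof -
    have "(\<Sum>w\<in>W. SUP f\<in>F. exp (D \<theta> f w))
      \<le> real (card W) * (2 ^ (card I + card J) * exp (n * (32 * \<tau> * R)\<^sup>2))"
      unfolding W_def n_def D_def by (rule exp_moment_bound[OF fin ne(2,3,4)]) (use F1 FR that in auto)
    then show ?thesis unfolding variance .
  qed
  have card_bad: "real (card (bad \<theta>)) \<le> real (card W) * (2 ^ (card I + card J) * exp (- Y))"
    if \<theta>: "\<bar>\<theta>\<bar> = \<tau>" for \<theta>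
  proof -
    have bdd: "bdd_above ((\<lambda>f. exp (D \<theta> f w)) ` F)" if w: "w \<in> W" for w
    proof (rule bdd_above_exp_image[where c="n * (\<tau> * 1)"])
      fix f assume f: "f \<in> F"
      have sq: "(f p)\<^sup>2 \<le> 1" if "p \<in> I \<times> J" for p using F1[OF f that] by (simp add: abs_square_le_1)
      have "(\<Sum>k\<in>K. (f (w k))\<^sup>2) \<le> n * 1"
        unfolding n_def using w by (intro sum_bounded_above sq) (auto simp: W_def)
      then have "(\<Sum>k\<in>K. (f (w k))\<^sup>2) / n \<le> 1" using n by (simp add: field_simps)
      moreover have "0 \<le> (\<Sum>k\<in>K. (f (w k))\<^sup>2) / n" using n by (simp add: sum_nonneg)
      moreover have "(\<Sum>p\<in>I \<times> J. (f p)\<^sup>2) \<le> real (card (I \<times> J)) * 1" by (intro sum_bounded_above sq)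
      then have "mean_square f (I \<times> J) \<le> 1"
        unfolding mean_square_def using fin ne by (subst divide_le_eq_1) (auto simp: card_gt_0_iff)
      moreover have "0 \<le> mean_square f (I \<times> J)" unfolding mean_square_def by (simp add: sum_nonneg)
      ultimately have "\<bar>(\<Sum>k\<in>K. (f (w k))\<^sup>2) / n - mean_square f (I \<times> J)\<bar> \<le> 1" by linarith
      then have "\<bar>\<theta> * ((\<Sum>k\<in>K. (f (w k))\<^sup>2) / n - mean_square f (I \<times> J))\<bar> \<le> \<tau> * 1"
        unfolding abs_mult \<theta> using \<tau> by (intro mult_left_mono) auto
      then show "D \<theta> f w \<le> n * (\<tau> * 1)" unfolding D_eq using n by (intro mult_left_mono) auto
    qed
    have "real (card (bad \<theta>)) * exp (1025 * Y) = (\<Sum>w\<in>bad \<theta>. exp (1025 * Y))" by simp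
    also have "\<dots> \<le> (\<Sum>w\<in>bad \<theta>. SUP f\<in>F. exp (D \<theta> f w))"
    proof (rule sum_mono)
      fix w assume "w \<in> bad \<theta>"
      then obtain f where "f \<in> F" "w \<in> W" "1025 * Y < D \<theta> f w" by (auto simp: bad_def)
      then show "exp (1025 * Y) \<le> (SUP f\<in>F. exp (D \<theta> f w))"
        by (intro cSUP_upper2[OF bdd, where x=f]) auto
    qed
    also have "\<dots> \<le> (\<Sum>w\<in>W. SUP f\<in>F. exp (D \<theta> f w))"
    proof (rule sum_mono2[OF finW])
      fix w assume "w \<in> W - bad \<theta>"
      moreover obtain f where "f \<in> F" using ne by auto
      ultimately show "0 \<le> (SUP f\<in>F. exp (D \<theta> f w))" by (intro cSUP_upper2[OF bdd, where x=f]) auto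
    qed (auto simp: bad_def)
    also have "\<dots> \<le> real (card W) * (2 ^ (card I + card J) * exp (1024 * Y))"
      by (rule moment[OF \<theta>])
    also have "exp (1024 * Y) = exp (- Y) * exp (1025 * Y)" by (simp flip: exp_add)
    finally show ?thesis by (simp add: mult_ac)
  qed
  have "{w \<in> W. \<exists>f\<in>F. 1025 * R * sqrt (Y / n) < \<bar>(\<Sum>k\<in>K. (f (w k))\<^sup>2) / n - mean_square f (I \<times> J)\<bar>}
    \<subseteq> bad \<tau> \<union> bad (- \<tau>)"
  proof safe
    fix w f assume w: "w \<in> W" "w \<notin> bad (- \<tau>)" and f: "f \<in> F"
      and dev: "1025 * R * sqrt (Y / n) < \<bar>(\<Sum>k\<in>K. (f (w k))\<^sup>2) / n - mean_square f (I \<times> J)\<bar>"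
    define d where "d = (\<Sum>k\<in>K. (f (w k))\<^sup>2) / n - mean_square f (I \<times> J)"
    have "1025 * Y < n * (\<tau> * \<bar>d\<bar>)"
      using dev \<tau> n unfolding level[symmetric] d_def by (intro mult_strict_left_mono) auto
    then have "1025 * Y < D \<tau> f w \<or> 1025 * Y < D (- \<tau>) f w"
      unfolding D_eq d_def[symmetric] by (auto simp: abs_if split: if_splits)
    then show "w \<in> bad \<tau>" using w f by (auto simp: bad_def)
  qed
  then have "real (card {w \<in> W. \<exists>f\<in>F. 1025 * R * sqrt (Y / n) < \<bar>(\<Sum>k\<in>K. (f (w k))\<^sup>2) / n - mean_square f (I \<times> J)\<bar>})
      \<le> real (card (bad \<tau> \<union> bad (- \<tau>)))"
    using finW by (intro of_nat_mono card_mono) (auto simp: bad_def)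
  also have "\<dots> \<le> real (card (bad \<tau>)) + real (card (bad (- \<tau>)))"
    using card_Un_le[of "bad \<tau>" "bad (- \<tau>)"] by linarith
  also have "\<dots> \<le> real (card W) * (2 ^ (card I + card J + 1) * exp (- Y))"
    using card_bad[of \<tau>] card_bad[of "- \<tau>"] \<tau> by simp
  finally show ?thesis unfolding W_def n_def .
qed

section \<open>Matrices, the rate, and the law of the sample\<close>

lemma L2_column_le_norm_1_to_2:
  assumes "A \<in> carrier_mat d m" "j < m"
  shows "L2_set (\<lambda>l. A $$ (l, j)) {..<d} \<le> norm_1_to_2 A"
proof -
  have eq: "{L2_set (\<lambda>i. A $$ (i, j)) {..<dim_row A} |j. j < dim_col A}
    = (\<lambda>j. L2_set (\<lambda>i. A $$ (i, j)) {..<d}) ` {..<m}" using assms by auto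
  show ?thesis unfolding norm_1_to_2_def eq using assms by (intro Max_ge) auto
qed

lemma norm_1_to_2_nonneg:
  assumes "A \<in> carrier_mat d m" "0 < m"
  shows "0 \<le> norm_1_to_2 A"
  using L2_column_le_norm_1_to_2[OF assms] L2_set_nonneg by (rule order_trans[rotated])

lemma row_squares_le_norm_1_to_2:
  assumes "U \<in> carrier_mat m d" "i < m"
  shows "(\<Sum>l<d. (U $$ (i, l))\<^sup>2) \<le> (norm_1_to_2 (transpose_mat U))\<^sup>2"
proof -
  have "L2_set (\<lambda>l. transpose_mat U $$ (l, i)) {..<d} \<le> norm_1_to_2 (transpose_mat U)"
    using assms by (intro L2_column_le_norm_1_to_2[of _ d m]) auto
  moreover have "L2_set (\<lambda>l. transpose_mat U $$ (l, i)) {..<d} = L2_set (\<lambda>l. U $$ (i, l)) {..<d}"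
    using assms by (intro L2_set_cong) auto
  ultimately have "(L2_set (\<lambda>l. U $$ (i, l)) {..<d})\<^sup>2 \<le> (norm_1_to_2 (transpose_mat U))\<^sup>2"
    by (intro power_mono) (auto simp: L2_set_nonneg)
  then show ?thesis by (simp add: L2_set_def sum_nonneg)
qed

lemma abs_entry_le_1:
  assumes M: "M \<in> carrier_mat d1 d2" "triple_norm r M \<le> 1" and p: "p \<in> {..<d1} \<times> {..<d2}"
  shows "\<bar>M $$ p\<bar> \<le> 1"
proof -
  have eq: "{\<bar>M $$ (i, j)\<bar> |i j. i < dim_row M \<and> j < dim_col M} = (\<lambda>p. \<bar>M $$ p\<bar>) ` ({..<d1} \<times> {..<d2})"
    using M by auto
  have "\<bar>M $$ p\<bar> \<le> entry_sup_norm M"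
    unfolding entry_sup_norm_def eq using p by (intro Max_ge) auto
  also have "\<dots> \<le> 1" using M by (simp add: triple_norm_def)
  finally show ?thesis .
qed

text \<open>The strict inequality yields an actual factorization, whether or not the infimum in the max norm is
  attained. The infimum is over a nonempty set because of the factorization \<open>1 M\<close>.\<close>
lemma factors_within_max_norm:
  assumes M: "M \<in> carrier_mat d1 d2" and pos: "0 < d1" "0 < d2" and R: "max_norm M < R"
  shows "factors_within R {..<d1} {..<d2} (\<lambda>p. M $$ p)"
proof -
  define Z where "Z = {norm_1_to_2 (transpose_mat U) * norm_1_to_2 (transpose_mat V) |U V d.
      U \<in> carrier_mat d1 d \<and> V \<in> carrier_mat d2 d \<and> U * transpose_mat V = M}"
  have "norm_1_to_2 (transpose_mat (1\<^sub>m d1)) * norm_1_to_2 (transpose_mat (transpose_mat M)) \<in> Z"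
    unfolding Z_def using M by (intro CollectI exI[of _ "1\<^sub>m d1"] exI[of _ "transpose_mat M"] exI[of _ d1]) auto
  then have "Z \<noteq> {}" by auto
  moreover have "Inf Z < R" using R M unfolding max_norm_def Z_def by simp
  ultimately obtain z where "z \<in> Z" "z < R" by (rule cInf_lessD[THEN bexE])
  then obtain U V d where U: "U \<in> carrier_mat d1 d" and V: "V \<in> carrier_mat d2 d" and UV: "U * transpose_mat V = M"
    and less: "norm_1_to_2 (transpose_mat U) * norm_1_to_2 (transpose_mat V) < R"
    unfolding Z_def by blast
  have "0 \<le> norm_1_to_2 (transpose_mat U)" "0 \<le> norm_1_to_2 (transpose_mat V)"
    using norm_1_to_2_nonneg[of "transpose_mat U" d d1] norm_1_to_2_nonneg[of "transpose_mat V" d d2] U V pos by auto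
  moreover have "M $$ (i, j) = (\<Sum>l<d. U $$ (i, l) * V $$ (j, l))" if "i < d1" "j < d2" for i j
    unfolding UV[symmetric] using that U V
    by (simp add: scalar_prod_def lessThan_atLeast0)
  ultimately show ?thesis
    unfolding factors_within_def
    using less row_squares_le_norm_1_to_2[OF U] row_squares_le_norm_1_to_2[OF V]
    by (intro exI[of _ "{..<d}"] exI[of _ "\<lambda>i l. U $$ (i, l)"] exI[of _ "\<lambda>j l. V $$ (j, l)"]
        exI[of _ "norm_1_to_2 (transpose_mat U)"] exI[of _ "norm_1_to_2 (transpose_mat V)"]) auto
qed

text \<open>Factor through the identity: the rows on the left are unit vectors, and those on the right are columns
  of length \<open>d1\<close> with entries bounded by \<open>1\<close>.\<close>
lemma factors_within_dim:
  assumes bound: "\<And>p. p \<in> {..<d1} \<times> J \<Longrightarrow> \<bar>f p\<bar> \<le> 1" and R: "sqrt (real d1) \<le> R"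
  shows "factors_within R {..<d1} J f"
  unfolding factors_within_def
proof (intro exI conjI ballI)
  show "(\<Sum>l<d1. (if i = l then 1 else 0 :: real)\<^sup>2) \<le> 1\<^sup>2" if "i \<in> {..<d1}" for i
    by (simp add: if_distrib[of "\<lambda>x. x\<^sup>2"] cong: if_cong)
  show "(\<Sum>l<d1. (f (l, j))\<^sup>2) \<le> (sqrt (real d1))\<^sup>2" if "j \<in> J" for j
    using sum_bounded_above[of "{..<d1}" "\<lambda>l. (f (l, j))\<^sup>2" 1] bound that
    by (auto simp: abs_square_le_1)
  show "f (i, j) = (\<Sum>l<d1. (if i = l then 1 else 0) * f (l, j))" if "i \<in> {..<d1}" for i j
    using that by (simp add: if_distrib[of "\<lambda>x. x * _"] cong: if_cong)
qed (use R in auto)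

text \<open>The supremum that defines the deviation is over a nonempty set; the zero matrix has a factorization
  with no columns at all.\<close>
lemma triple_norm_zero_le_1:
  assumes "0 < d1" "0 < d2"
  shows "triple_norm r (0\<^sub>m d1 d2) \<le> 1"
proof -
  have "{\<bar>0\<^sub>m d1 d2 $$ (i, j) :: real\<bar> |i j. i < d1 \<and> j < d2} = {0}"
    using assms by (auto intro!: exI[of _ 0])
  then have entry: "entry_sup_norm (0\<^sub>m d1 d2) = 0" unfolding entry_sup_norm_def by simp
  define Z where "Z = {norm_1_to_2 (transpose_mat U) * norm_1_to_2 (transpose_mat V) |U V d.
      U \<in> carrier_mat d1 d \<and> V \<in> carrier_mat d2 d \<and> U * transpose_mat V = 0\<^sub>m d1 d2}"
  have "bdd_below Z"
  proof (rule bdd_belowI[of _ 0])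
    fix z assume "z \<in> Z"
    then obtain U V d where UV: "U \<in> carrier_mat d1 d" "V \<in> carrier_mat d2 d"
      and z: "z = norm_1_to_2 (transpose_mat U) * norm_1_to_2 (transpose_mat V)"
      unfolding Z_def by blast
    show "0 \<le> z"
      unfolding z using UV assms
      by (intro mult_nonneg_nonneg norm_1_to_2_nonneg[of _ d d1] norm_1_to_2_nonneg[of _ d d2]) auto
  qed
  moreover have "0 \<in> Z"
  proof -
    have "{L2_set (\<lambda>i. transpose_mat (0\<^sub>m d1 0) $$ (i, j)) {..<0} |j. j < d1} = {0 :: real}"
      using assms by (auto simp: L2_set_def)
    then have "norm_1_to_2 (transpose_mat (0\<^sub>m d1 0)) = 0" unfolding norm_1_to_2_def by simp
    moreover have "0\<^sub>m d1 0 * transpose_mat (0\<^sub>m d2 0) = (0\<^sub>m d1 d2 :: real mat)"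
      by (rule eq_matI) (auto simp: scalar_prod_def)
    ultimately show ?thesis
      unfolding Z_def
      by (intro CollectI exI[of _ "0\<^sub>m d1 0"] exI[of _ "0\<^sub>m d2 0"] exI[of _ 0]) simp
  qed
  ultimately have "Inf Z \<le> 0" by (intro cInf_lower)
  then have "max_norm (0\<^sub>m d1 d2) \<le> 0" unfolding max_norm_def Z_def by simp
  then have "max_norm (0\<^sub>m d1 d2) / sqrt (real r) \<le> 0" by (simp add: divide_le_0_iff)
  then show ?thesis unfolding triple_norm_def entry by simp
qed

text \<open>If \<open>x \<le> D\<close>, the factor \<open>r\<close> of the minimum suffices and \<open>ln D \<ge> 1/2\<close> absorbs the logarithms; if
  \<open>x > D\<close>, the factor \<open>d \<le> D < x\<close> makes everything quadratic in \<open>x\<close>.\<close>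
lemma radius_exponent_le_rate:
  fixes r d D :: nat and x :: real
  assumes "0 < r" "2 \<le> D" "d \<le> D" "0 < x"
  shows "4 * real (min r d) * (2 * real D + x) \<le> 100 * max (real r * real D * ln (real D) ^ 3) (x\<^sup>2)"
proof (cases "x \<le> real D")
  case True
  have "1 / 2 \<le> ln (real D)"
  proof -
    have "ln 2 \<le> ln (real D)" using assms by simp
    then show ?thesis using ln2_ge_two_thirds by linarith
  qed
  then have "(1 / 2) ^ 3 \<le> ln (real D) ^ 3" by (intro power_mono) auto
  then have ln3: "1 \<le> 8 * ln (real D) ^ 3" by (simp add: power_divide)
  have "4 * real (min r d) * (2 * real D + x) \<le> 4 * real r * (3 * real D)"
    using True assms by (intro mult_mono) auto
  also have "\<dots> = 12 * (real r * real D) * 1" by simp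
  also have "\<dots> \<le> 12 * (real r * real D) * (8 * ln (real D) ^ 3)"
    using ln3 by (intro mult_left_mono) auto
  also have "\<dots> = 96 * (real r * real D * ln (real D) ^ 3)" by simp
  also have "\<dots> \<le> 100 * (real r * real D * ln (real D) ^ 3)"
    using \<open>1 / 2 \<le> ln (real D)\<close> by (intro mult_right_mono) auto
  also have "\<dots> \<le> 100 * max (real r * real D * ln (real D) ^ 3) (x\<^sup>2)" by simp
  finally show ?thesis .
next
  case False
  have "4 * real (min r d) * (2 * real D + x) \<le> 4 * x * (3 * x)"
    using False assms by (intro mult_mono) auto
  also have "\<dots> \<le> 100 * x\<^sup>2" by (simp add: power2_eq_square)
  also have "\<dots> \<le> 100 * max (real r * real D * ln (real D) ^ 3) (x\<^sup>2)" by simp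
  finally show ?thesis .
qed

lemma sampling_deviation_cong:
  assumes "\<And>k. k \<in> {1..n} \<Longrightarrow> x k = y k"
  shows "sampling_deviation d1 d2 n r x = sampling_deviation d1 d2 n r y"
proof -
  have "(\<Sum>k = 1..n. \<bar>M $$ x k\<bar>\<^sup>2) = (\<Sum>k = 1..n. \<bar>M $$ y k\<bar>\<^sup>2)" for M :: "real mat"
    by (intro sum.cong refl) (use assms in auto)
  then show ?thesis unfolding sampling_deviation_def by simp
qed

text \<open>The exponent \<open>Y = 2 (d1 + d2) + ln (1/\<zeta>)\<close> pays for the \<open>2^(d1 + d2 + 1)\<close> sign patterns and the two
  directions of deviation, with \<open>exp (- ln (1/\<zeta>)) = \<zeta>\<close> left over.\<close>
lemma few_samples_with_large_deviation:
  assumes pos: "0 < d1" "0 < d2" "0 < n" "0 < r" and \<zeta>: "0 < \<zeta>" "\<zeta> < 1"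
    and \<rho>: "\<rho> = sampling_rate d1 d2 n r \<zeta>"
  defines "W \<equiv> {1..n} \<rightarrow>\<^sub>E {..<d1} \<times> {..<d2}"
  shows "real (card {w \<in> W. \<not> sampling_deviation d1 d2 n r w \<le> 10250 * real d1 * real d2 * max \<rho> (sqrt \<rho>)})
    \<le> \<zeta> * real (card W)"
proof -
  define ball where "ball = {M \<in> carrier_mat d1 d2. triple_norm r M \<le> 1}"
  define F where "F = (\<lambda>M p. M $$ p) ` ball"
  define x where "x = ln (inverse \<zeta>)"
  define D where "D = d1 + d2"
  define Y where "Y = 2 * real D + x"
  define R where "R = 2 * sqrt (real (min r d1))"
  define K where "K = {1..n}"
  have x: "0 < x" unfolding x_def using \<zeta> by (simp add: one_less_inverse_iff)
  have Y: "0 < Y" unfolding Y_def using x by simp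
  have R: "0 < R" unfolding R_def using pos by simp
  have D: "2 \<le> D" "d1 \<le> D" unfolding D_def using pos by auto
  have n: "real (card K) = real n" by (simp add: K_def)
  have finW: "finite W" unfolding W_def by (intro finite_PiE) auto
  have "0\<^sub>m d1 d2 \<in> ball" unfolding ball_def using triple_norm_zero_le_1 pos by simp
  then have ne: "ball \<noteq> {}" by auto
  have F1: "\<bar>f p\<bar> \<le> 1" if "f \<in> F" "p \<in> {..<d1} \<times> {..<d2}" for f p
    using that abs_entry_le_1[of _ d1 d2 r p] by (auto simp: F_def ball_def)
  have FR: "factors_within R {..<d1} {..<d2} f" if f: "f \<in> F" for f
  proof -
    obtain M where M: "M \<in> carrier_mat d1 d2" "triple_norm r M \<le> 1" and fM: "f = (\<lambda>p. M $$ p)"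
      using f by (auto simp: F_def ball_def)
    show ?thesis
    proof (cases "r \<le> d1")
      case True
      have "max_norm M / sqrt (real r) \<le> 1" using M by (simp add: triple_norm_def)
      then have "max_norm M \<le> sqrt (real r)" using pos by simp
      also have "\<dots> < R" unfolding R_def using True pos by simp
      finally show ?thesis unfolding fM by (intro factors_within_max_norm M pos)
    next
      case False
      then show ?thesis using F1[OF f] by (intro factors_within_dim) (auto simp: R_def)
    qed
  qed
  have level: "R * sqrt (Y / n) \<le> 10 * sqrt \<rho>"
  proof -
    have "(R * sqrt (Y / n))\<^sup>2 = 4 * real (min r d1) * (2 * real D + x) / n"
      unfolding R_def Y_def using x by (simp add: power_mult_distrib)
    also have "\<dots> \<le> 100 * max (real r * real D * ln (real D) ^ 3) (x\<^sup>2) / n"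
      using pos D x by (intro divide_right_mono radius_exponent_le_rate) auto
    also have "\<dots> = 100 * \<rho>" unfolding \<rho> sampling_rate_def D_def x_def by simp
    finally have "sqrt ((R * sqrt (Y / n))\<^sup>2) \<le> sqrt (100 * \<rho>)" by (rule real_sqrt_le_mono)
    then show ?thesis using R Y by (simp add: real_sqrt_mult)
  qed
  have prob: "2 ^ (D + 1) * exp (- Y) \<le> \<zeta>"
  proof -
    have "(2 :: real) ^ (D + 1) \<le> 2 ^ (2 * D)" using D by (intro power_increasing) auto
    also have "\<dots> \<le> exp 1 ^ (2 * D)" using exp_ge_add_one_self[of 1] by (intro power_mono) auto
    also have "\<dots> = exp (2 * real D)" by (simp add: exp_of_nat_mult[symmetric])
    finally have "2 ^ (D + 1) * exp (- Y) \<le> exp (2 * real D) * exp (- Y)" by (intro mult_right_mono) auto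
    also have "\<dots> = exp (- x)" unfolding Y_def by (simp flip: exp_add)
    also have "\<dots> = \<zeta>" unfolding x_def using \<zeta> by (simp add: ln_inverse)
    finally show ?thesis .
  qed
  define bad where "bad = {w \<in> W. \<exists>f\<in>F.
      1025 * R * sqrt (Y / n) < \<bar>(\<Sum>k\<in>K. (f (w k))\<^sup>2) / n - mean_square f ({..<d1} \<times> {..<d2})\<bar>}"
  have "{w \<in> W. \<not> sampling_deviation d1 d2 n r w \<le> 10250 * real d1 * real d2 * max \<rho> (sqrt \<rho>)} \<subseteq> bad"
  proof (rule subsetI, rule ccontr, clarify)
    fix w assume "w \<in> W" "w \<notin> bad"
      and large: "\<not> sampling_deviation d1 d2 n r w \<le> 10250 * real d1 * real d2 * max \<rho> (sqrt \<rho>)"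
    have "sampling_deviation d1 d2 n r w \<le> 10250 * real d1 * real d2 * max \<rho> (sqrt \<rho>)"
      unfolding sampling_deviation_def ball_def[symmetric]
    proof (rule cSUP_least[OF ne])
      fix M assume M: "M \<in> ball"
      then have dim: "dim_row M = d1" "dim_col M = d2" by (auto simp: ball_def)
      define \<delta> where "\<delta> = (\<Sum>k\<in>K. (M $$ w k)\<^sup>2) / n - mean_square (\<lambda>p. M $$ p) ({..<d1} \<times> {..<d2})"
      have "(frobenius_norm M)\<^sup>2 = (\<Sum>p\<in>{..<d1} \<times> {..<d2}. (M $$ p)\<^sup>2)"
        unfolding frobenius_norm_def L2_set_def dim by (simp add: sum_nonneg)
      then have "real d1 * real d2 / real n * (\<Sum>k=1..n. \<bar>M $$ w k\<bar>\<^sup>2) - (frobenius_norm M)\<^sup>2 = real d1 * real d2 * \<delta>"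
        unfolding \<delta>_def mean_square_def K_def using pos by (simp add: card_cartesian_product field_simps)
      then have "\<bar>real d1 * real d2 / real n * (\<Sum>k=1..n. \<bar>M $$ w k\<bar>\<^sup>2) - (frobenius_norm M)\<^sup>2\<bar> = real d1 * real d2 * \<bar>\<delta>\<bar>"
        by (simp add: abs_mult)
      also have "\<bar>\<delta>\<bar> \<le> 1025 * (R * sqrt (Y / n))"
        using \<open>w \<in> W\<close> \<open>w \<notin> bad\<close> M unfolding bad_def \<delta>_def F_def by (auto simp: not_less)
      then have "real d1 * real d2 * \<bar>\<delta>\<bar> \<le> real d1 * real d2 * (10250 * max \<rho> (sqrt \<rho>))"
        using level by (intro mult_left_mono) auto
      finally show "\<bar>real d1 * real d2 / real n * (\<Sum>k=1..n. \<bar>M $$ w k\<bar>\<^sup>2) - (frobenius_norm M)\<^sup>2\<bar>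
          \<le> 10250 * real d1 * real d2 * max \<rho> (sqrt \<rho>)" by (simp add: mult_ac)
    qed
    with large show False by simp
  qed
  then have "real (card {w \<in> W. \<not> sampling_deviation d1 d2 n r w \<le> 10250 * real d1 * real d2 * max \<rho> (sqrt \<rho>)})
      \<le> real (card bad)"
    using finW by (intro of_nat_mono card_mono) (auto simp: bad_def)
  also have "\<dots> \<le> real (card W) * (2 ^ (card {..<d1} + card {..<d2} + 1) * exp (- Y))"
    unfolding bad_def W_def K_def[symmetric] n[symmetric]
  proof (rule few_deviating_samples)
    show "F \<noteq> {}" using ne by (simp add: F_def)
  qed (use pos R Y F1 FR in \<open>auto simp: K_def\<close>)
  also have "\<dots> = real (card W) * (2 ^ (D + 1) * exp (- Y))" by (simp add: D_def)
  also have "\<dots> \<le> real (card W) * \<zeta>" using prob by (intro mult_left_mono) auto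
  finally show ?thesis by (simp add: mult.commute)
qed

text \<open>The sample takes each value in the finite function space with the same probability, so a count of good
  values is a lower bound for the probability of the event. The event is measurable because it depends
  on finitely many coordinates with values in a countable set.\<close>
lemma prob_of_independent_uniform_indices:
  fixes \<Omega> :: "'a measure"
  assumes X: "independent_uniform_indices \<Omega> d1 d2 n X" and pos: "0 < d1" "0 < d2" "0 < n"
    and local: "\<And>x y. (\<And>k. k \<in> {1..n} \<Longrightarrow> x k = y k) \<Longrightarrow> P x \<longleftrightarrow> P y"
    and few: "real (card {w \<in> {1..n} \<rightarrow>\<^sub>E {..<d1} \<times> {..<d2}. \<not> P w})
      \<le> \<zeta> * real (card ({1..n} \<rightarrow>\<^sub>E {..<d1} \<times> {..<d2}))"
  shows "1 - \<zeta> \<le> measure \<Omega> {\<omega> \<in> space \<Omega>. P (\<lambda>k. X k \<omega>)}"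
proof -
  interpret prob_space \<Omega> using X by (simp add: independent_uniform_indices_def)
  have indep: "indep_vars (\<lambda>_. count_space UNIV) X {1..n}"
    and law: "\<And>k. k \<in> {1..n} \<Longrightarrow> distr \<Omega> (count_space UNIV) (X k) = measure_pmf (uniform_index d1 d2)"
    using X by (auto simp: independent_uniform_indices_def)
  have meas: "X k \<in> measurable \<Omega> (count_space UNIV)" if "k \<in> {1..n}" for k
    using indep that by (auto simp: indep_vars_def2)
  define I where "I = {..<d1} \<times> {..<d2}"
  define W where "W = ({1..n} \<rightarrow>\<^sub>E I)"
  define A where "A z = (\<Inter>k\<in>{1..n}. X k -` {z k} \<inter> space \<Omega>)" for z
  have I: "finite I" "I \<noteq> {}" unfolding I_def using pos by auto
  have finW: "finite W" unfolding W_def using I by (intro finite_PiE) auto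
  have cardW: "real (card W) = real (card I) ^ n" unfolding W_def by (simp add: card_PiE)
  have W0: "0 < real (card W)" unfolding cardW using I by (simp add: card_gt_0_iff)
  have A_sets: "A z \<in> sets \<Omega>" for z
    unfolding A_def using pos meas by (intro sets.finite_INT measurable_sets[OF meas]) auto
  have A_iff: "\<omega> \<in> A z \<longleftrightarrow> \<omega> \<in> space \<Omega> \<and> (\<forall>k\<in>{1..n}. X k \<omega> = z k)" for \<omega> z
    unfolding A_def using pos by auto
  have prob_A: "prob (A w) = 1 / real (card W)" if w: "w \<in> W" for w
  proof -
    have "prob (X k -` {w k} \<inter> space \<Omega>) = 1 / real (card I)" if k: "k \<in> {1..n}" for k
    proof -
      have "prob (X k -` {w k} \<inter> space \<Omega>) = measure (distr \<Omega> (count_space UNIV) (X k)) {w k}"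
        using meas[OF k] by (simp add: measure_distr)
      also have "\<dots> = pmf (uniform_index d1 d2) (w k)" unfolding law[OF k] by (simp add: measure_pmf_single)
      also have "\<dots> = 1 / real (card I)"
        using w k I unfolding uniform_index_def I_def[symmetric] W_def by (auto simp: PiE_iff)
      finally show ?thesis .
    qed
    then have "prob (A w) = (\<Prod>k\<in>{1..n}. 1 / real (card I))"
      unfolding A_def using pos by (subst indep_varsD_finite[OF indep]) auto
    then show ?thesis by (simp add: cardW power_one_over)
  qed
  have "{\<omega> \<in> space \<Omega>. P (\<lambda>k. X k \<omega>)} = (\<Union>z\<in>{z \<in> {1..n} \<rightarrow>\<^sub>E UNIV. P z}. A z)"
  proof (rule subset_antisym; rule subsetI)
    fix \<omega> assume \<omega>: "\<omega> \<in> {\<omega> \<in> space \<Omega>. P (\<lambda>k. X k \<omega>)}"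
    define z where "z = restrict (\<lambda>k. X k \<omega>) {1..n}"
    have "P z" using \<omega> local[of z "\<lambda>k. X k \<omega>"] by (simp add: z_def)
    moreover have "\<omega> \<in> A z" using \<omega> by (simp add: A_iff z_def)
    ultimately show "\<omega> \<in> (\<Union>z\<in>{z \<in> {1..n} \<rightarrow>\<^sub>E UNIV. P z}. A z)"
      by (intro UN_I[of z]) (auto simp: z_def)
  next
    fix \<omega> assume "\<omega> \<in> (\<Union>z\<in>{z \<in> {1..n} \<rightarrow>\<^sub>E UNIV. P z}. A z)"
    then obtain z where "P z" "\<omega> \<in> A z" by auto
    then show "\<omega> \<in> {\<omega> \<in> space \<Omega>. P (\<lambda>k. X k \<omega>)}"
      using local[of z "\<lambda>k. X k \<omega>"] by (auto simp: A_iff)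
  qed
  moreover have "countable {z \<in> {1..n} \<rightarrow>\<^sub>E (UNIV :: (nat \<times> nat) set). P z}"
    by (rule countable_subset[OF _ countable_PiE[of "{1..n}" "\<lambda>_. UNIV"]]) auto
  ultimately have event: "{\<omega> \<in> space \<Omega>. P (\<lambda>k. X k \<omega>)} \<in> events"
    using A_sets by (auto intro!: sets.countable_UN'')
  have "real (card W) = real (card {w\<in>W. P w}) + real (card {w\<in>W. \<not> P w})"
    unfolding of_nat_add[symmetric]
    by (subst card_Un_disjoint[symmetric]) (use finW in \<open>auto intro!: arg_cong[where f=card]\<close>)
  then have "(1 - \<zeta>) * real (card W) \<le> real (card {w\<in>W. P w})"
    using few unfolding W_def[symmetric] I_def[symmetric] by (simp add: algebra_simps)
  then have "1 - \<zeta> \<le> real (card {w\<in>W. P w}) * (1 / real (card W))"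
    using W0 by (simp add: field_simps)
  also have "\<dots> = (\<Sum>w\<in>{w\<in>W. P w}. prob (A w))" by (simp add: prob_A)
  also have "\<dots> = prob (\<Union>w\<in>{w\<in>W. P w}. A w)"
  proof (rule finite_measure_finite_Union[symmetric])
    have "w = w'" if "\<omega> \<in> A w" "\<omega> \<in> A w'" "w \<in> W" "w' \<in> W" for w w' \<omega>
      using that(3,4) unfolding W_def by (rule PiE_ext) (use that(1,2) in \<open>auto simp: A_iff\<close>)
    then show "disjoint_family_on A {w \<in> W. P w}" by (auto simp: disjoint_family_on_def)
  qed (use finW A_sets in auto)
  also have "\<dots> \<le> prob {\<omega> \<in> space \<Omega>. P (\<lambda>k. X k \<omega>)}"
  proof (rule finite_measure_mono[OF _ event])
    show "(\<Union>w\<in>{w\<in>W. P w}. A w) \<subseteq> {\<omega> \<in> space \<Omega>. P (\<lambda>k. X k \<omega>)}"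
    proof safe
      fix w \<omega> assume "P w" "\<omega> \<in> A w"
      then show "\<omega> \<in> space \<Omega>" "P (\<lambda>k. X k \<omega>)"
        using local[of w "\<lambda>k. X k \<omega>"] by (auto simp: A_iff)
    qed
  qed
  finally show ?thesis .
qed

lemma independent_uniform_indices_index_sample_pmf:
  "independent_uniform_indices (measure_pmf (index_sample_pmf d1 d2 n)) d1 d2 n (\<lambda>k x. x k)"
  unfolding independent_uniform_indices_def index_sample_pmf_def
  by (simp add: measure_pmf.prob_space_axioms indep_vars_Pi_pmf map_pmf_rep_eq[symmetric] Pi_pmf_component)

theorem lemma6p5:
  "\<exists>C::real. \<forall>(d1::nat) (d2::nat) (n::nat) (r::nat) (\<zeta>::real).
     0 < d1 \<longrightarrow> 0 < d2 \<longrightarrow> 0 < n \<longrightarrow> 0 < r \<longrightarrow> 0 < \<zeta> \<longrightarrow> \<zeta> < 1 \<longrightarrow>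
     (let \<rho> = sampling_rate d1 d2 n r \<zeta>;
          B = C * real d1 * real d2 * max \<rho> (sqrt \<rho>)
      in (\<forall>(\<Omega>::'a measure) X. independent_uniform_indices \<Omega> d1 d2 n X \<longrightarrow>
            measure \<Omega> {\<omega> \<in> space \<Omega>. sampling_deviation d1 d2 n r (\<lambda>k. X k \<omega>) \<le> B} \<ge> 1 - \<zeta>)
       \<and> measure_pmf.prob (index_sample_pmf d1 d2 n)
            {x. sampling_deviation d1 d2 n r x \<le> B} \<ge> 1 - \<zeta>)"
proof (rule exI[of _ 10250], intro allI impI)
  fix d1 d2 n r :: nat and \<zeta> :: real
  assume pos: "0 < d1" "0 < d2" "0 < n" "0 < r" and \<zeta>: "0 < \<zeta>" "\<zeta> < 1"
  define \<rho> where "\<rho> = sampling_rate d1 d2 n r \<zeta>"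
  define B where "B = 10250 * real d1 * real d2 * max \<rho> (sqrt \<rho>)"
  have few: "real (card {w \<in> {1..n} \<rightarrow>\<^sub>E {..<d1} \<times> {..<d2}. \<not> sampling_deviation d1 d2 n r w \<le> B})
    \<le> \<zeta> * real (card ({1..n} \<rightarrow>\<^sub>E {..<d1} \<times> {..<d2}))"
    unfolding B_def by (rule few_samples_with_large_deviation[OF pos \<zeta> \<rho>_def])
  have local: "sampling_deviation d1 d2 n r x \<le> B \<longleftrightarrow> sampling_deviation d1 d2 n r y \<le> B"
    if "\<And>k. k \<in> {1..n} \<Longrightarrow> x k = y k" for x y
    using sampling_deviation_cong[of n x y d1 d2 r] that by simp
  have "1 - \<zeta> \<le> measure \<Omega> {\<omega> \<in> space \<Omega>. sampling_deviation d1 d2 n r (\<lambda>k. X k \<omega>) \<le> B}"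
    if "independent_uniform_indices \<Omega> d1 d2 n X" for \<Omega> :: "'a measure" and X
    by (rule prob_of_independent_uniform_indices[OF that pos(1-3) local few])
  moreover have "1 - \<zeta> \<le> measure_pmf.prob (index_sample_pmf d1 d2 n) {x. sampling_deviation d1 d2 n r x \<le> B}"
    using prob_of_independent_uniform_indices[OF independent_uniform_indices_index_sample_pmf pos(1-3) local few]
    by simp
  ultimately show "let \<rho> = sampling_rate d1 d2 n r \<zeta>;
          B = 10250 * real d1 * real d2 * max \<rho> (sqrt \<rho>)
      in (\<forall>(\<Omega>::'a measure) X. independent_uniform_indices \<Omega> d1 d2 n X \<longrightarrow>
            measure \<Omega> {\<omega> \<in> space \<Omega>. sampling_deviation d1 d2 n r (\<lambda>k. X k \<omega>) \<le> B} \<ge> 1 - \<zeta>)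
       \<and> measure_pmf.prob (index_sample_pmf d1 d2 n)
            {x. sampling_deviation d1 d2 n r x \<le> B} \<ge> 1 - \<zeta>"
    unfolding Let_def B_def \<rho>_def by blast
qed

end
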